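(* A (finite simple) graph $G$ is a cpsd-graph if and only if $G$ has no subgraph isomorphic to the cycle $C_{2t+1}$ for any integer $t\ge 2$.
   Context: Graphs have vertex set $[n]$ and no loops or multiple edges. A subgraph of $G$ is a graph whose vertex and edge sets are subsets of those of $G$. The cycle $C_k$ has vertex set $[k]$ with $u\sim v$ iff $u-v\equiv \pm1 \pmod k$. A real symmetric matrix is doubly nonnegative (DNN) if it is positive semidefinite and entrywise nonnegative. An $n\times n$ matrix $X$ is completely positive semidefinite (cpsd) if there exist $d\ge1$ and Hermitian positive semidefinite $d\times d$ matrices $P_1,\dots,P_n$ with $X_{ij}=\mathrm{Tr}(P_iP_j)$ for all $i,j$. The support graph $S(X)$ of a symmetric $n\times n$ matrix $X$ is the graph on $[n]$ with $u\sim v$ iff $u\neq v$ and $X_{uv}\neq 0$. A graph $G$ on $[n]$ is a cpsd-graph if every $n\times n$ doubly nonnegative matrix $X$ with $S(X)=G$ is cpsd. *)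

theory Defs
  imports "HOL-Analysis.Analysis"
begin

definition is_graph :: "nat \<Rightarrow> (nat \<times> nat) set \<Rightarrow> bool" where
  "is_graph n G \<longleftrightarrow> G \<subseteq> {1..n} \<times> {1..n} \<and> (\<forall>u v. (u, v) \<in> G \<longrightarrow> (v, u) \<in> G)
     \<and> (\<forall>u. (u, u) \<notin> G)"

definition cycle_graph :: "nat \<Rightarrow> (nat \<times> nat) set" where
  "cycle_graph k = {(u, v). u \<in> {1..k} \<and> v \<in> {1..k} \<and>
      ((int u - int v) mod int k = 1 mod int k \<or> (int u - int v) mod int k = (-1) mod int k)}"

definition has_subgraph_iso :: "nat \<Rightarrow> (nat \<times> nat) set \<Rightarrow> nat \<Rightarrow> (nat \<times> nat) set \<Rightarrow> bool" where
  "has_subgraph_iso n G m H \<longleftrightarrow> (\<exists>f. inj_on f {1..m} \<and> f ` {1..m} \<subseteq> {1..n} \<and>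
      (\<forall>u v. (u, v) \<in> H \<longrightarrow> (f u, f v) \<in> G))"

definition real_symmetric :: "nat \<Rightarrow> (nat \<Rightarrow> nat \<Rightarrow> real) \<Rightarrow> bool" where
  "real_symmetric n X \<longleftrightarrow> (\<forall>i\<in>{1..n}. \<forall>j\<in>{1..n}. X i j = X j i)"

definition real_psd :: "nat \<Rightarrow> (nat \<Rightarrow> nat \<Rightarrow> real) \<Rightarrow> bool" where
  "real_psd n X \<longleftrightarrow> real_symmetric n X \<and>
     (\<forall>x :: nat \<Rightarrow> real. (\<Sum>i\<in>{1..n}. \<Sum>j\<in>{1..n}. x i * X i j * x j) \<ge> 0)"

definition DNN :: "nat \<Rightarrow> (nat \<Rightarrow> nat \<Rightarrow> real) \<Rightarrow> bool" where
  "DNN n X \<longleftrightarrow> real_psd n X \<and> (\<forall>i\<in>{1..n}. \<forall>j\<in>{1..n}. X i j \<ge> 0)"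

definition hermitian :: "nat \<Rightarrow> (nat \<Rightarrow> nat \<Rightarrow> complex) \<Rightarrow> bool" where
  "hermitian d P \<longleftrightarrow> (\<forall>i<d. \<forall>j<d. P j i = cnj (P i j))"

definition hermitian_psd :: "nat \<Rightarrow> (nat \<Rightarrow> nat \<Rightarrow> complex) \<Rightarrow> bool" where
  "hermitian_psd d P \<longleftrightarrow> hermitian d P \<and>
     (\<forall>v :: nat \<Rightarrow> complex. Re (\<Sum>i<d. \<Sum>j<d. cnj (v i) * P i j * v j) \<ge> 0)"

definition trace_prod :: "nat \<Rightarrow> (nat \<Rightarrow> nat \<Rightarrow> complex) \<Rightarrow> (nat \<Rightarrow> nat \<Rightarrow> complex) \<Rightarrow> complex" where
  "trace_prod d P Q = (\<Sum>i<d. \<Sum>j<d. P i j * Q j i)"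

definition cpsd :: "nat \<Rightarrow> (nat \<Rightarrow> nat \<Rightarrow> real) \<Rightarrow> bool" where
  "cpsd n X \<longleftrightarrow> (\<exists>d \<ge> 1. \<exists>P :: nat \<Rightarrow> nat \<Rightarrow> nat \<Rightarrow> complex.
      (\<forall>i\<in>{1..n}. hermitian_psd d (P i)) \<and>
      (\<forall>i\<in>{1..n}. \<forall>j\<in>{1..n}. complex_of_real (X i j) = trace_prod d (P i) (P j)))"

definition support_graph :: "nat \<Rightarrow> (nat \<Rightarrow> nat \<Rightarrow> real) \<Rightarrow> (nat \<times> nat) set" where
  "support_graph n X = {(u, v). u \<in> {1..n} \<and> v \<in> {1..n} \<and> u \<noteq> v \<and> X u v \<noteq> 0}"

definition cpsd_graph :: "nat \<Rightarrow> (nat \<times> nat) set \<Rightarrow> bool" where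
  "cpsd_graph n G \<longleftrightarrow> (\<forall>X. DNN n X \<and> support_graph n X = G \<longrightarrow> cpsd n X)"

end

theory Submission
  imports Defs
begin

text \<open>
  If the support of a doubly nonnegative matrix has no odd cycle of length at least 5, the matrix is completely
  positive, hence cpsd with diagonal factors. Induct on the number of vertices and edges. A bipartite support is
  handled through the comparison matrix, a simplicial vertex by subtracting a multiple of its column's rank one
  matrix, and a cut vertex by splitting the matrix into two positive semidefinite pieces. One of the three always
  applies: if the graph is not bipartite it contains a triangle, and without a cut vertex each component of the
  complement of that triangle is a single simplicial vertex.

  Conversely, an odd cycle \<open>1, \<dots>, k\<close> with \<open>k \<ge> 5\<close> supports a doubly nonnegative matrix with a kernel vector \<open>w\<close>
  such that \<open>w\<^sub>1 = 0\<close> and \<open>w\<^sub>2 = - w\<^sub>k\<close>. If it were the Gram matrix of positive matrices \<open>P\<^sub>i\<close>, then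
  \<open>\<Sum>\<^sub>i w\<^sub>i P\<^sub>i = 0\<close> and multiplication by \<open>P\<^sub>1\<close> would give \<open>P\<^sub>1 P\<^sub>2 = P\<^sub>1 P\<^sub>k\<close>; as \<open>P\<^sub>2 P\<^sub>k = 0\<close>, this forces \<open>P\<^sub>1 P\<^sub>2 = 0\<close>.
  Since the support must be the whole graph and the cpsd cone is not closed, the argument is carried out for
  a perturbation of size \<open>\<epsilon>\<close> with bounds that do not depend on the size of the matrices \<open>P\<^sub>i\<close>: the spectral projection
  onto the positive part of \<open>P\<^sub>2 - P\<^sub>k\<close> replaces multiplication by \<open>P\<^sub>2\<close>.
\<close>

section \<open>Positive semidefinite forms on a finite index set\<close>

definition quad :: "'a set \<Rightarrow> ('a \<Rightarrow> 'a \<Rightarrow> real) \<Rightarrow> ('a \<Rightarrow> real) \<Rightarrow> real" where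
  "quad V X x = (\<Sum>i\<in>V. \<Sum>j\<in>V. x i * X i j * x j)"

definition psd_on :: "'a set \<Rightarrow> ('a \<Rightarrow> 'a \<Rightarrow> real) \<Rightarrow> bool" where
  "psd_on V X \<longleftrightarrow> (\<forall>i\<in>V. \<forall>j\<in>V. X i j = X j i) \<and> (\<forall>x. 0 \<le> quad V X x)"

lemma psd_on_sym: "psd_on V X \<Longrightarrow> i \<in> V \<Longrightarrow> j \<in> V \<Longrightarrow> X i j = X j i"
  by (auto simp: psd_on_def)

lemma psd_on_nonneg: "psd_on V X \<Longrightarrow> 0 \<le> quad V X x"
  by (auto simp: psd_on_def)

lemma quad_cong:
  assumes "\<And>i j. i \<in> V \<Longrightarrow> j \<in> V \<Longrightarrow> X i j = Y i j" "\<And>i. i \<in> V \<Longrightarrow> x i = y i"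
  shows "quad V X x = quad V Y y"
  unfolding quad_def using assms by (intro sum.cong refl) auto

lemma psd_on_cong:
  assumes "psd_on V X" "\<And>i j. i \<in> V \<Longrightarrow> j \<in> V \<Longrightarrow> X i j = Y i j"
  shows "psd_on V Y"
proof -
  have "quad V X x = quad V Y x" for x
    by (rule quad_cong) (auto simp: assms(2))
  then show ?thesis using assms by (auto simp: psd_on_def)
qed

lemma quad_mono_neutral:
  assumes "finite V" "A \<subseteq> V"
    "\<And>i j. i \<in> V \<Longrightarrow> j \<in> V \<Longrightarrow> \<not> (i \<in> A \<and> j \<in> A) \<Longrightarrow> x i * X i j * x j = 0"
  shows "quad V X x = quad A X x"
proof -
  have "quad V X x = (\<Sum>i\<in>V. \<Sum>j\<in>A. x i * X i j * x j)"
    unfolding quad_def using assms by (intro sum.cong refl sum.mono_neutral_right) auto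
  also have "\<dots> = quad A X x"
    unfolding quad_def using assms by (intro sum.mono_neutral_right) (auto intro!: sum.neutral)
  finally show ?thesis .
qed

lemma psd_on_subset:
  assumes "finite V" "psd_on V X" "A \<subseteq> V"
  shows "psd_on A X"
  unfolding psd_on_def
proof (intro conjI ballI allI)
  fix i j assume "i \<in> A" "j \<in> A"
  then show "X i j = X j i" using assms psd_on_sym by (metis subsetD)
next
  fix x :: "'a \<Rightarrow> real"
  let ?x = "\<lambda>i. if i \<in> A then x i else 0"
  have "quad A X x = quad A X ?x" by (rule quad_cong) auto
  also have "\<dots> = quad V X ?x" by (rule quad_mono_neutral[symmetric]) (use assms in auto)
  finally show "0 \<le> quad A X x" using psd_on_nonneg[OF assms(2)] by simp
qed

lemma quad_add_matrix: "quad V (\<lambda>i j. X i j + Y i j) x = quad V X x + quad V Y x"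
  by (simp add: quad_def algebra_simps sum.distrib)

lemma quad_scale_matrix: "quad V (\<lambda>i j. c * X i j) x = c * quad V X x"
  by (simp add: quad_def algebra_simps sum_distrib_left)

lemma quad_rank1: "quad V (\<lambda>i j. b i * b j) x = (\<Sum>i\<in>V. b i * x i)^2"
  by (simp add: quad_def power2_eq_square sum_product algebra_simps)

lemma quad_scale_vector: "quad V X (\<lambda>i. c * x i) = c^2 * quad V X x"
  by (simp add: quad_def power2_eq_square algebra_simps sum_distrib_left)

lemma quad_add_vector:
  assumes "\<And>i j. i \<in> V \<Longrightarrow> j \<in> V \<Longrightarrow> X i j = X j i"
  shows "quad V X (\<lambda>i. x i + y i) = quad V X x + 2 * (\<Sum>i\<in>V. y i * (\<Sum>j\<in>V. X i j * x j)) + quad V X y"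
proof -
  have "(\<Sum>i\<in>V. \<Sum>j\<in>V. x i * X i j * y j) = (\<Sum>i\<in>V. \<Sum>j\<in>V. y i * X i j * x j)"
    by (subst sum.swap) (intro sum.cong refl, use assms in \<open>simp add: mult.commute mult.left_commute\<close>)
  then show ?thesis
    by (simp add: quad_def algebra_simps sum.distrib sum_distrib_left)
qed

lemma quad_unit:
  assumes "finite V" "i \<in> V"
  shows "quad V X (\<lambda>j. if j = i then t else 0) = t^2 * X i i"
proof -
  have "quad V X (\<lambda>j. if j = i then t else 0) = (\<Sum>j\<in>{i}. \<Sum>k\<in>{i}. t * X j k * t)"
    by (subst quad_mono_neutral[where A = "{i}"]) (use assms in \<open>auto simp: quad_def\<close>)
  then show ?thesis by (simp add: power2_eq_square)
qed

lemma quad_add_unit: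
  assumes "finite V" "i \<in> V" "\<And>i j. i \<in> V \<Longrightarrow> j \<in> V \<Longrightarrow> X i j = X j i"
  shows "quad V X (\<lambda>j. x j + (if j = i then t else 0))
    = quad V X x + 2 * t * (\<Sum>j\<in>V. X i j * x j) + t^2 * X i i"
proof -
  have "(\<Sum>k\<in>V. (if k = i then t else 0) * c k) = t * c i" for c :: "'a \<Rightarrow> real"
  proof -
    have "(\<Sum>k\<in>V. (if k = i then t else 0) * c k) = (\<Sum>k\<in>V. if k = i then t * c k else 0)"
      by (intro sum.cong) auto
    then show ?thesis using assms(1,2) by (simp add: sum.delta)
  qed
  then show ?thesis
    by (subst quad_add_vector) (simp_all add: assms quad_unit)
qed

lemma psd_on_diag_nonneg:
  assumes "finite V" "psd_on V X" "i \<in> V"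
  shows "0 \<le> X i i"
  using quad_unit[OF assms(1,3), of X 1] psd_on_nonneg[OF assms(2)] by simp metis

lemma quadratic_nonneg_imp_linear_zero:
  fixes a p :: real
  assumes "\<And>t. 0 \<le> 2 * t * a + t^2 * p" "0 \<le> p"
  shows "a = 0"
proof (rule ccontr)
  assume "a \<noteq> 0"
  \<comment> \<open>The minimiser \<open>- a / p\<close> is undefined for \<open>p = 0\<close>; the
    denominator \<open>1 + p\<close> is always positive and still gives a negative value.\<close>
  have "2 * (- a / (1 + p)) * a + (- a / (1 + p))^2 * p = - (a^2 * (2 + p)) / (1 + p)^2"
    using assms(2) by (simp add: divide_simps power2_eq_square) (simp add: algebra_simps)
  also have "\<dots> < 0" using \<open>a \<noteq> 0\<close> assms(2) by (simp add: divide_neg_pos)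
  finally show False using assms(1)[of "- a / (1 + p)"] by simp
qed

text \<open>Moving away from a zero of the form along coordinate \<open>i\<close> gives a quadratic
  in the step \<open>t\<close> with no constant term. It is nonnegative for every \<open>t\<close>,
  so its linear coefficient, row \<open>i\<close> of \<open>X\<close> applied to \<open>x\<close>,
  vanishes.\<close>

lemma psd_on_kernel:
  assumes "finite V" "psd_on V X" "quad V X x = 0" "i \<in> V"
  shows "(\<Sum>j\<in>V. X i j * x j) = 0"
proof (rule quadratic_nonneg_imp_linear_zero)
  show "0 \<le> X i i" using psd_on_diag_nonneg[OF assms(1,2,4)] .
  fix t
  have "quad V X (\<lambda>j. x j + (if j = i then t else 0)) = 2 * t * (\<Sum>j\<in>V. X i j * x j) + t^2 * X i i"
    using quad_add_unit[OF assms(1,4) psd_on_sym[OF assms(2)], where x = x and t = t] assms(3) by simp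
  then show "0 \<le> 2 * t * (\<Sum>j\<in>V. X i j * x j) + t^2 * X i i"
    using psd_on_nonneg[OF assms(2)] by metis
qed

lemma psd_on_zero_diag:
  assumes "finite V" "psd_on V X" "i \<in> V" "j \<in> V" "X i i = 0"
  shows "X i j = 0"
proof -
  have "quad V X (\<lambda>j. if j = i then 1 else 0) = 0"
    using quad_unit[OF assms(1,3), of X 1] assms(5) by simp
  from psd_on_kernel[OF assms(1,2) this assms(4)]
  have "(\<Sum>k\<in>V. if k = i then X j k else 0) = 0"
    by (simp add: if_distrib cong: if_cong)
  then have "X j i = 0" using assms by simp
  then show ?thesis using psd_on_sym[OF assms(2,3,4)] by simp
qed

text \<open>The new form at \<open>x\<close> is the old form at \<open>x\<close> with coordinate
  \<open>i\<close> shifted to its minimum. The complement stays indexed by all of \<open>V\<close>,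
  with row and column \<open>i\<close> equal to zero.\<close>

lemma psd_on_schur:
  assumes "finite V" "psd_on V X" "i \<in> V" "X i i > 0"
  shows "psd_on V (\<lambda>j k. X j k - X i j * X i k / X i i)"
  unfolding psd_on_def
proof (intro conjI ballI allI)
  fix j k assume "j \<in> V" "k \<in> V"
  then show "X j k - X i j * X i k / X i i = X k j - X i k * X i j / X i i"
    using psd_on_sym[OF assms(2), of j k] by simp
next
  fix x :: "'a \<Rightarrow> real"
  let ?L = "\<Sum>j\<in>V. X i j * x j"
  have "quad V (\<lambda>j k. X j k - X i j * X i k / X i i) x
      = quad V (\<lambda>j k. X j k + (- 1 / X i i) * (X i j * X i k)) x" by (simp add: field_simps)
  also have "\<dots> = quad V X x - ?L^2 / X i i"
    by (subst quad_add_matrix, subst quad_scale_matrix, subst quad_rank1) simp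
  also have "\<dots> = quad V X (\<lambda>j. x j + (if j = i then - ?L / X i i else 0))"
    by (subst quad_add_unit) (use assms psd_on_sym[OF assms(2)] in \<open>auto simp: field_simps power2_eq_square\<close>)
  finally show "0 \<le> quad V (\<lambda>j k. X j k - X i j * X i k / X i i) x"
    using psd_on_nonneg[OF assms(2)] by simp
qed

lemma psd_on_add: "psd_on V X \<Longrightarrow> psd_on V Y \<Longrightarrow> psd_on V (\<lambda>i j. X i j + Y i j)"
  by (auto simp: psd_on_def quad_add_matrix)

lemma psd_on_scale: "psd_on V X \<Longrightarrow> 0 \<le> c \<Longrightarrow> psd_on V (\<lambda>i j. c * X i j)"
  by (auto simp: psd_on_def quad_scale_matrix)

section \<open>Completely positive matrices\<close>

text \<open>A list of vectors allows repeated summands and makes addition a concatenation. The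
  vectors are nonnegative at every index, so constructions from data on \<open>V\<close> have to cut
  off outside \<open>V\<close>.\<close>

definition completely_positive :: "'a set \<Rightarrow> ('a \<Rightarrow> 'a \<Rightarrow> real) \<Rightarrow> bool" where
  "completely_positive V X \<longleftrightarrow> (\<exists>bs. (\<forall>b\<in>set bs. \<forall>i. 0 \<le> b i) \<and>
     (\<forall>i\<in>V. \<forall>j\<in>V. X i j = (\<Sum>b\<leftarrow>bs. b i * b j)))"

lemma completely_positive_cong:
  assumes "completely_positive V X" "\<And>i j. i \<in> V \<Longrightarrow> j \<in> V \<Longrightarrow> X i j = Y i j"
  shows "completely_positive V Y"
  using assms unfolding completely_positive_def by metis

lemma completely_positive_add:
  assumes "completely_positive V X" "completely_positive V Y"
  shows "completely_positive V (\<lambda>i j. X i j + Y i j)"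
proof -
  obtain bs cs where "\<forall>b\<in>set bs. \<forall>i. 0 \<le> b i" "\<forall>i\<in>V. \<forall>j\<in>V. X i j = (\<Sum>b\<leftarrow>bs. b i * b j)"
    "\<forall>b\<in>set cs. \<forall>i. 0 \<le> b i" "\<forall>i\<in>V. \<forall>j\<in>V. Y i j = (\<Sum>b\<leftarrow>cs. b i * b j)"
    using assms unfolding completely_positive_def by blast
  then show ?thesis unfolding completely_positive_def
    by (intro exI[of _ "bs @ cs"]) auto
qed

lemma completely_positive_rank1:
  assumes "\<And>i. i \<in> V \<Longrightarrow> 0 \<le> b i"
  shows "completely_positive V (\<lambda>i j. b i * b j)"
  unfolding completely_positive_def
  by (intro exI[of _ "[\<lambda>i. if i \<in> V then b i else 0]"]) (use assms in auto)

lemma completely_positive_scaled_rank1: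
  assumes "\<And>i. i \<in> V \<Longrightarrow> 0 \<le> b i" "0 \<le> c"
  shows "completely_positive V (\<lambda>i j. c * b i * b j)"
proof -
  have "completely_positive V (\<lambda>i j. (sqrt c * b i) * (sqrt c * b j))"
    by (rule completely_positive_rank1) (use assms in auto)
  then show ?thesis
    by (rule completely_positive_cong) (use assms(2) in \<open>simp add: algebra_simps flip: power2_eq_square\<close>)
qed

lemma completely_positive_zero: "completely_positive V (\<lambda>i j. 0)"
  unfolding completely_positive_def by (intro exI[of _ "[]"]) auto

lemma completely_positive_sum:
  assumes "finite K" "\<And>k. k \<in> K \<Longrightarrow> completely_positive V (X k)"
  shows "completely_positive V (\<lambda>i j. \<Sum>k\<in>K. X k i j)"
  using assms
proof (induction K rule: finite_induct)
  case empty
  then show ?case by (simp add: completely_positive_zero)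
next
  case (insert k K)
  have "completely_positive V (\<lambda>i j. X k i j + (\<Sum>k\<in>K. X k i j))"
    by (rule completely_positive_add) (use insert in auto)
  then show ?case by (rule completely_positive_cong) (use insert in auto)
qed

lemma completely_positive_extend:
  assumes "completely_positive A X" "A \<subseteq> V"
    "\<And>i j. i \<in> V \<Longrightarrow> j \<in> V \<Longrightarrow> \<not> (i \<in> A \<and> j \<in> A) \<Longrightarrow> X i j = 0"
  shows "completely_positive V X"
proof -
  obtain bs where bs: "\<forall>b\<in>set bs. \<forall>i. 0 \<le> b i" "\<forall>i\<in>A. \<forall>j\<in>A. X i j = (\<Sum>b\<leftarrow>bs. b i * b j)"
    using assms unfolding completely_positive_def by blast
  let ?cs = "map (\<lambda>b i. if i \<in> A then b i else 0) bs"
  have "X i j = (\<Sum>b\<leftarrow>?cs. b i * b j)" if "i \<in> V" "j \<in> V" for i j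
    using bs(2) assms(3)[OF that] by (cases "i \<in> A \<and> j \<in> A") (auto simp: o_def)
  then show ?thesis unfolding completely_positive_def
    by (intro exI[of _ ?cs]) (use bs(1) in auto)
qed

text \<open>This is the positive vector of a symmetric, possibly singular M-matrix. Eliminating one
  index keeps the off-diagonal entries nonpositive, because the subtracted product of two
  nonpositive entries is nonnegative; the vector for the Schur complement is then extended by one
  coordinate.\<close>

lemma psd_nonpos_offdiag_positive_vector:
  assumes "finite V" "psd_on V M" "\<And>i j. i \<in> V \<Longrightarrow> j \<in> V \<Longrightarrow> i \<noteq> j \<Longrightarrow> M i j \<le> 0"
  shows "\<exists>u. (\<forall>i\<in>V. 0 < u i) \<and> (\<forall>i\<in>V. 0 \<le> (\<Sum>j\<in>V. M i j * u j))"
  using assms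
proof (induction V arbitrary: M rule: finite_induct)
  case empty
  then show ?case by simp
next
  case (insert i V)
  have sym: "M j k = M k j" if "j \<in> insert i V" "k \<in> insert i V" for j k
    using psd_on_sym[OF insert.prems(1)] that by blast
  have psdV: "psd_on V M" by (rule psd_on_subset[OF _ insert.prems(1)]) (use insert.hyps in auto)
  show ?case
  proof (cases "M i i = 0")
    case True
    have zero: "M i j = 0" if "j \<in> insert i V" for j
      using psd_on_zero_diag[OF _ insert.prems(1) _ that True] insert.hyps by blast
    obtain u where u: "\<forall>j\<in>V. 0 < u j" "\<forall>j\<in>V. 0 \<le> (\<Sum>k\<in>V. M j k * u k)"
      using insert.IH[OF psdV] insert.prems(2) by blast
    let ?u = "u(i := 1)"
    have "(\<Sum>k\<in>insert i V. M j k * ?u k) = (\<Sum>k\<in>V. M j k * u k)" if "j \<in> V" for j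
    proof -
      have "M j i = 0" using zero[of j] sym[of i j] that by auto
      moreover have "(\<Sum>k\<in>V. M j k * ?u k) = (\<Sum>k\<in>V. M j k * u k)"
        by (intro sum.cong) (use insert.hyps in auto)
      ultimately show ?thesis using insert.hyps by simp
    qed
    moreover have "(\<Sum>k\<in>insert i V. M i k * ?u k) = 0"
      by (intro sum.neutral) (use zero in auto)
    ultimately show ?thesis using u by (intro exI[of _ ?u]) auto
  next
    case False
    then have pos: "M i i > 0" using psd_on_diag_nonneg[OF _ insert.prems(1), of i] insert.hyps by simp
    let ?N = "\<lambda>j k. M j k - M i j * M i k / M i i"
    have "psd_on V ?N"
      by (rule psd_on_subset[OF _ psd_on_schur[OF _ insert.prems(1) _ pos]]) (use insert.hyps in auto)
    moreover have "?N j k \<le> 0" if "j \<in> V" "k \<in> V" "j \<noteq> k" for j k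
    proof -
      have "0 \<le> M i j * M i k / M i i"
        by (intro divide_nonneg_pos mult_nonpos_nonpos pos insert.prems(2)) (use that insert.hyps in auto)
      then show ?thesis using insert.prems(2)[of j k] that by simp
    qed
    ultimately obtain u where u: "\<forall>j\<in>V. 0 < u j" "\<forall>j\<in>V. 0 \<le> (\<Sum>k\<in>V. ?N j k * u k)"
      using insert.IH by blast
    define S where "S = (\<Sum>k\<in>V. M i k * u k)"
    have terms: "M i k * u k \<le> 0" if "k \<in> V" for k
      using insert.prems(2)[of i k] u(1) that insert.hyps
      by (intro mult_nonpos_nonneg) (auto simp: less_imp_le)
    have "S \<le> 0" unfolding S_def by (intro sum_nonpos terms)
    \<comment> \<open>Setting entry \<open>i\<close> of the product to zero gives
      \<open>- S / M i i\<close>. If \<open>S = 0\<close>, then positivity of \<open>u\<close>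
      forces row \<open>i\<close> to vanish off the diagonal, and any positive value will
      do.\<close>
    define t where "t = (if S = 0 then 1 else - S / M i i)"
    let ?u = "u(i := t)"
    have "t > 0" unfolding t_def using \<open>S \<le> 0\<close> pos by (auto simp: divide_neg_pos)
    have S0: "M i k = 0" if "S = 0" "k \<in> V" for k
    proof -
      have "- (M i k * u k) = 0"
        using sum_nonneg_eq_0_iff[of V "\<lambda>k. - (M i k * u k)"] insert.hyps(1) terms that
        unfolding S_def by (auto simp: sum_negf)
      then show ?thesis using u(1) that by auto
    qed
    have Mt: "M i k * t = - M i k * S / M i i" if "k \<in> V" for k
      using S0[OF _ that] by (cases "S = 0") (auto simp: t_def)
    have split: "(\<Sum>k\<in>insert i V. M j k * ?u k) = M j i * t + (\<Sum>k\<in>V. M j k * u k)" for j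
    proof -
      have "(\<Sum>k\<in>V. M j k * ?u k) = (\<Sum>k\<in>V. M j k * u k)"
        by (intro sum.cong) (use insert.hyps in auto)
      then show ?thesis using insert.hyps by simp
    qed
    have "0 \<le> (\<Sum>k\<in>insert i V. M j k * ?u k)" if "j \<in> V" for j
    proof -
      have "(\<Sum>k\<in>V. ?N j k * u k) = (\<Sum>k\<in>V. M j k * u k) - M i j / M i i * S"
        unfolding S_def by (simp add: algebra_simps sum_subtractf sum_distrib_left)
      also have "\<dots> = M j i * t + (\<Sum>k\<in>V. M j k * u k)"
        using Mt[OF that] sym[of j i] that by simp
      finally show ?thesis using bspec[OF u(2) that] by (simp only: split)
    qed
    moreover have "0 \<le> (\<Sum>k\<in>insert i V. M i k * ?u k)"
    proof -
      have "0 \<le> M i i * t + S" unfolding t_def using pos by auto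
      then show ?thesis unfolding S_def by (simp only: split)
    qed
    ultimately show ?thesis using u(1) \<open>t > 0\<close> by (intro exI[of _ ?u]) auto
  qed
qed

lemma completely_positive_diagonal:
  assumes "finite V" "\<And>i. i \<in> V \<Longrightarrow> 0 \<le> r i"
  shows "completely_positive V (\<lambda>i j. if i = j then r i else 0)"
proof -
  have "completely_positive V (\<lambda>i j. \<Sum>k\<in>V. r k * of_bool (i = k) * of_bool (j = k))"
    by (intro completely_positive_sum completely_positive_scaled_rank1 assms) auto
  then show ?thesis
  proof (rule completely_positive_cong)
    fix i j assume "i \<in> V" "j \<in> V"
    have "(\<Sum>k\<in>V. r k * of_bool (i = k) * of_bool (j = k)) = (\<Sum>k\<in>V. if i = k then r k * of_bool (j = k) else 0)"
      by (intro sum.cong) auto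
    then show "(\<Sum>k\<in>V. r k * of_bool (i = k) * of_bool (j = k)) = (if i = j then r i else 0)"
      using assms(1) \<open>i \<in> V\<close> by auto
  qed
qed

text \<open>Negating the off-diagonal entries preserves positive semidefiniteness by flipping the signs
  on one colour class; a positive vector as above then rescales the matrix to a diagonally dominant one.\<close>

lemma bipartite_completely_positive:
  fixes c :: "'a \<Rightarrow> bool"
  assumes "finite V" "psd_on V X" "\<And>i j. i \<in> V \<Longrightarrow> j \<in> V \<Longrightarrow> 0 \<le> X i j"
    "\<And>i j. i \<in> V \<Longrightarrow> j \<in> V \<Longrightarrow> i \<noteq> j \<Longrightarrow> X i j \<noteq> 0 \<Longrightarrow> c i \<noteq> c j"
  shows "completely_positive V X"
proof -
  let ?M = "\<lambda>i j. if i = j then X i j else - X i j"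
  note sym = psd_on_sym[OF assms(2)]
  have "psd_on V ?M"
    unfolding psd_on_def
  proof (intro conjI ballI allI)
    fix i j assume "i \<in> V" "j \<in> V"
    then show "?M i j = ?M j i" using sym by simp
  next
    fix x :: "'a \<Rightarrow> real"
    let ?y = "\<lambda>i. if c i then x i else - x i"
    have "quad V ?M x = quad V X ?y"
      unfolding quad_def
    proof (intro sum.cong refl)
      fix i j assume "i \<in> V" "j \<in> V"
      then show "x i * ?M i j * x j = ?y i * X i j * ?y j"
        using assms(4)[of i j] by (cases "i = j"; cases "X i j = 0") auto
    qed
    then show "0 \<le> quad V ?M x" using psd_on_nonneg[OF assms(2)] by simp
  qed
  then have "\<exists>u. (\<forall>i\<in>V. 0 < u i) \<and> (\<forall>i\<in>V. 0 \<le> (\<Sum>j\<in>V. ?M i j * u j))"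
    by (rule psd_nonpos_offdiag_positive_vector[OF assms(1)]) (use assms(3) in auto)
  then obtain u where u: "\<And>i. i \<in> V \<Longrightarrow> 0 < u i" "\<And>i. i \<in> V \<Longrightarrow> 0 \<le> (\<Sum>j\<in>V. ?M i j * u j)"
    by blast
  \<comment> \<open>What remains of the diagonal after each neighbour \<open>j\<close> has received
    the share \<open>X i j * (u j / u i)\<close>. It is nonnegative since \<open>u i * r i\<close>
    is entry \<open>i\<close> of \<open>?M\<close> applied to \<open>u\<close>.\<close>
  define r where "r i = X i i - (\<Sum>j\<in>V - {i}. X i j * (u j / u i))" for i
  have r: "0 \<le> r i" if "i \<in> V" for i
  proof -
    have "(\<Sum>j\<in>V. ?M i j * u j) = X i i * u i + (\<Sum>j\<in>V-{i}. ?M i j * u j)"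
      using assms(1) that by (simp add: sum.remove)
    also have "(\<Sum>j\<in>V-{i}. ?M i j * u j) = (\<Sum>j\<in>V-{i}. - X i j * u j)"
      by (intro sum.cong) auto
    also have "X i i * u i + \<dots> = u i * r i"
    proof -
      have "u i * (\<Sum>j\<in>V-{i}. X i j * (u j / u i)) = (\<Sum>j\<in>V-{i}. X i j * u j)"
        unfolding sum_distrib_left by (intro sum.cong refl) (use u(1)[OF that] in simp)
      then show ?thesis unfolding r_def by (simp add: sum_negf algebra_simps)
    qed
    finally show ?thesis using u(1,2)[OF that] by (simp add: zero_le_mult_iff)
  qed
  let ?P = "{(k, l). k \<in> V \<and> l \<in> V \<and> k \<noteq> l}"
  have finP: "finite ?P" by (rule finite_subset[of _ "V \<times> V"]) (use assms(1) in auto)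
  \<comment> \<open>The two entries multiply to 1, so they reproduce \<open>X k l\<close> off the
    diagonal, while their squares are the two diagonal shares. Both orientations of a pair lie in
    \<open>?P\<close>, whence the weight \<open>X k l / 2\<close>.\<close>
  define b where "b = (\<lambda>(k, l) i. if i = k then sqrt (u l / u k) else if i = l then sqrt (u k / u l) else 0)"
  let ?Z = "\<lambda>p i j. (case p of (k, l) \<Rightarrow> X k l / 2) * b p i * b p j"
  have "completely_positive V (\<lambda>i j. (\<Sum>p\<in>?P. ?Z p i j) + (if i = j then r i else 0))"
    using assms(3) u(1)
    by (intro completely_positive_add completely_positive_sum finP completely_positive_scaled_rank1
        completely_positive_diagonal assms(1) r) (auto simp: b_def less_imp_le)
  then show ?thesis
  proof (rule completely_positive_cong)
    fix i j assume ij: "i \<in> V" "j \<in> V"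
    show "(\<Sum>p\<in>?P. ?Z p i j) + (if i = j then r i else 0) = X i j"
    proof (cases "i = j")
      case False
      have "(\<Sum>p\<in>?P. ?Z p i j) = (\<Sum>p\<in>{(i, j), (j, i)}. ?Z p i j)"
        by (intro sum.mono_neutral_right finP) (use ij False in \<open>auto simp: b_def split: if_splits\<close>)
      also have "\<dots> = X i j"
        using False u(1)[OF ij(1)] u(1)[OF ij(2)] sym[OF ij] by (simp add: b_def flip: real_sqrt_mult)
      finally show ?thesis using False by simp
    next
      case True
      let ?A = "(\<lambda>l. (i, l)) ` (V - {i})" and ?B = "(\<lambda>l. (l, i)) ` (V - {i})"
      have sq: "b (i, l) i * b (i, l) i = u l / u i" "b (l, i) i * b (l, i) i = u l / u i"
        if "l \<in> V" "l \<noteq> i" for l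
        using u(1)[OF that(1)] u(1)[OF ij(1)] that(2) by (auto simp: b_def)
      have "(\<Sum>p\<in>?P. ?Z p i i) = (\<Sum>p\<in>?A \<union> ?B. ?Z p i i)"
        by (intro sum.mono_neutral_right finP) (use ij in \<open>auto simp: b_def image_iff split: if_splits\<close>)
      also have "\<dots> = (\<Sum>p\<in>?A. ?Z p i i) + (\<Sum>p\<in>?B. ?Z p i i)"
        by (intro sum.union_disjoint) (use assms(1) in auto)
      also have "(\<Sum>p\<in>?A. ?Z p i i) = (\<Sum>l\<in>V-{i}. X i l / 2 * (u l / u i))"
        by (subst sum.reindex) (auto simp: inj_on_def sq mult.assoc intro!: sum.cong)
      also have "(\<Sum>p\<in>?B. ?Z p i i) = (\<Sum>l\<in>V-{i}. X i l / 2 * (u l / u i))"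
        by (subst sum.reindex) (use ij sym in \<open>auto simp: inj_on_def sq mult.assoc intro!: sum.cong\<close>)
      finally show ?thesis using True unfolding r_def by (simp add: sum_divide_distrib[symmetric] flip: sum.distrib)
    qed
  qed
qed

text \<open>The Schur complement of a simplicial vertex has no fill-in. If it has a negative entry, then a smaller
  multiple of the same rank one matrix already removes an edge.\<close>

lemma simplicial_reduction:
  assumes "finite V" "psd_on V X" "\<And>i j. i \<in> V \<Longrightarrow> j \<in> V \<Longrightarrow> 0 \<le> X i j" "i \<in> V"
    "\<And>j k. j \<in> V - {i} \<Longrightarrow> k \<in> V - {i} \<Longrightarrow> j \<noteq> k \<Longrightarrow> X i j \<noteq> 0 \<Longrightarrow> X i k \<noteq> 0 \<Longrightarrow> X j k \<noteq> 0"
  obtains (vertex) Y where "psd_on (V - {i}) Y" "\<And>j k. j \<in> V - {i} \<Longrightarrow> k \<in> V - {i} \<Longrightarrow> 0 \<le> Y j k"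
      "\<And>j k. j \<in> V - {i} \<Longrightarrow> k \<in> V - {i} \<Longrightarrow> j \<noteq> k \<Longrightarrow> X j k = 0 \<Longrightarrow> Y j k = 0"
      "completely_positive (V - {i}) Y \<Longrightarrow> completely_positive V X"
    | (edge) Y j k where "psd_on V Y" "\<And>j k. j \<in> V \<Longrightarrow> k \<in> V \<Longrightarrow> 0 \<le> Y j k"
      "\<And>j k. j \<in> V \<Longrightarrow> k \<in> V \<Longrightarrow> j \<noteq> k \<Longrightarrow> X j k = 0 \<Longrightarrow> Y j k = 0"
      "j \<in> V" "k \<in> V" "j \<noteq> k" "X j k \<noteq> 0" "Y j k = 0"
      "completely_positive V Y \<Longrightarrow> completely_positive V X"
proof (cases "X i i = 0")
  case True
  have row: "X i j = 0" "X j i = 0" if "j \<in> V" for j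
    using psd_on_zero_diag[OF assms(1,2,4) that True] psd_on_sym[OF assms(2,4) that] by auto
  show ?thesis
  proof (rule vertex[of X])
    show "psd_on (V - {i}) X" by (rule psd_on_subset[OF assms(1,2)]) auto
    show "completely_positive V X" if "completely_positive (V - {i}) X"
      by (rule completely_positive_extend[OF that]) (use row in auto)
  qed (use assms(3) in auto)
next
  case False
  then have pos: "X i i > 0" using assms(3)[OF assms(4,4)] by simp
  define p where "p = X i i"
  have p: "p > 0" using pos by (simp add: p_def)
  let ?S = "\<lambda>j k. X j k - X i j * X i k / X i i"
  have psdS: "psd_on V ?S" by (rule psd_on_schur[OF assms(1,2,4) pos])
  note sym = psd_on_sym[OF assms(2)]
  let ?P = "{(j, k). j \<in> V - {i} \<and> k \<in> V - {i} \<and> j \<noteq> k \<and> X i j \<noteq> 0 \<and> X i k \<noteq> 0}"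
  have finP: "finite ?P" by (rule finite_subset[of _ "V \<times> V"]) (use assms(1) in auto)
  \<comment> \<open>The largest multiple of the rank one matrix of column \<open>i\<close> that can
    be subtracted before entry \<open>(j, k)\<close> turns negative. The Schur complement uses the
    multiple \<open>1 / p\<close>.\<close>
  define ratio where "ratio = (\<lambda>(j, k). X j k / (X i j * X i k))"
  show ?thesis
  proof (cases "\<forall>q\<in>?P. 1 / p \<le> ratio q")
    case True
    show ?thesis
    proof (rule vertex[of ?S])
      show "psd_on (V - {i}) ?S" by (rule psd_on_subset[OF assms(1) psdS]) auto
      show "0 \<le> ?S j k" if jk: "j \<in> V - {i}" "k \<in> V - {i}" for j k
      proof (cases "(j, k) \<in> ?P")
        case in_P: True
        then have "0 < X i j * X i k"
          using assms(3)[OF assms(4), of j] assms(3)[OF assms(4), of k] jk by auto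
        moreover have "1 / p \<le> X j k / (X i j * X i k)" using True in_P by (auto simp: ratio_def)
        ultimately show ?thesis using p by (simp add: p_def field_simps)
      next
        case notin: False
        show ?thesis
        proof (cases "j = k")
          case True
          then show ?thesis using psd_on_diag_nonneg[OF assms(1) psdS, of j] jk by simp
        next
          case False
          then have "X i j * X i k = 0" using notin jk by auto
          then have "?S j k = X j k" by (simp only: div_0 diff_zero)
          then show ?thesis using assms(3) jk by (metis DiffD1)
        qed
      qed
      show "?S j k = 0" if "j \<in> V - {i}" "k \<in> V - {i}" "j \<noteq> k" "X j k = 0" for j k
        using assms(5)[OF that(1,2,3)] that(4) by auto
      show "completely_positive V X" if "completely_positive (V - {i}) ?S"
      proof -
        have "completely_positive V ?S"
          by (rule completely_positive_extend[OF that]) (use assms(4) pos sym in auto)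
        moreover have "completely_positive V (\<lambda>j k. (1 / X i i) * X i j * X i k)"
          by (rule completely_positive_scaled_rank1) (use assms(3,4) pos in auto)
        ultimately have "completely_positive V (\<lambda>j k. ?S j k + (1 / X i i) * X i j * X i k)"
          by (rule completely_positive_add)
        then show ?thesis by (rule completely_positive_cong) simp
      qed
    qed
  next
    case False
    then have "?P \<noteq> {}" by blast
    \<comment> \<open>The first threshold reached: subtracting \<open>s\<close> times the rank one
      matrix makes one entry zero and none negative.\<close>
    define s where "s = Min (ratio ` ?P)"
    have "s \<in> ratio ` ?P" unfolding s_def by (intro Min_in) (use finP \<open>?P \<noteq> {}\<close> in auto)
    then obtain j k where jk: "(j, k) \<in> ?P" "s = ratio (j, k)" by auto
    have s_le: "s \<le> ratio q" if "q \<in> ?P" for q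
      unfolding s_def by (intro Min_le) (use finP that in auto)
    have "s < 1 / p" using False s_le by fastforce
    have pos_prod: "0 < X i j * X i k" if "(j, k) \<in> ?P" for j k
      using assms(3)[OF assms(4), of j] assms(3)[OF assms(4), of k] that by auto
    have "0 \<le> s" using jk pos_prod[OF jk(1)] assms(3)[of j k] by (auto simp: ratio_def)
    let ?Y = "\<lambda>a b. X a b - s * X i a * X i b"
    have sp: "s * p < 1" using \<open>s < 1 / p\<close> p by (simp add: field_simps)
    \<comment> \<open>\<open>?Y\<close> is a convex combination of \<open>X\<close> and its Schur
      complement, with weight \<open>s * p < 1\<close> on the latter.\<close>
    have psdY: "psd_on V ?Y"
    proof (rule psd_on_cong)
      show "psd_on V (\<lambda>a b. (1 - s * p) * X a b + s * p * ?S a b)"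
        by (intro psd_on_add psd_on_scale assms psdS) (use sp \<open>0 \<le> s\<close> p in auto)
    qed (use p in \<open>simp add: p_def field_simps\<close>)
    have Y_i: "?Y i b = (1 - s * p) * X i b" for b by (simp add: p_def algebra_simps)
    show ?thesis
    proof (rule edge[of ?Y j k])
      show "psd_on V ?Y" by (rule psdY)
      show "0 \<le> ?Y a b" if ab: "a \<in> V" "b \<in> V" for a b
      proof -
        have Yib: "0 \<le> ?Y i b" if "b \<in> V" for b
          unfolding Y_i using assms(3)[OF assms(4) that] sp by simp
        consider "a = b" | "a = i" | "b = i" | "X i a * X i b = 0" | "(a, b) \<in> ?P"
          using ab by auto
        then show ?thesis
        proof cases
          case 1
          then show ?thesis using psd_on_diag_nonneg[OF assms(1) psdY, of a] ab by simp
        next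
          case 2
          then show ?thesis using Yib ab by simp
        next
          case 3
          then show ?thesis using Yib[of a] ab sym[of a b] by (simp add: mult.commute mult.left_commute)
        next
          case 4
          then show ?thesis using assms(3)[OF ab] by auto
        next
          case 5
          then show ?thesis using s_le[OF 5] pos_prod[OF 5] by (simp add: ratio_def field_simps)
        qed
      qed
      show "?Y a b = 0" if "a \<in> V" "b \<in> V" "a \<noteq> b" "X a b = 0" for a b
        using assms(5)[of a b] that sym[of a b] by (cases "a = i"; cases "b = i") auto
      show "j \<in> V" "k \<in> V" "j \<noteq> k" using jk by auto
      show "X j k \<noteq> 0" using assms(5)[of j k] jk by auto
      show "?Y j k = 0" using jk pos_prod[OF jk(1)] by (auto simp: ratio_def)
      show "completely_positive V X" if "completely_positive V ?Y"
      proof -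
        have "completely_positive V (\<lambda>j k. s * X i j * X i k)"
          by (rule completely_positive_scaled_rank1) (use assms(3,4) \<open>0 \<le> s\<close> in auto)
        from completely_positive_add[OF that this] show ?thesis
          by (rule completely_positive_cong) simp
      qed
    qed
  qed
qed

text \<open>The pieces overlap only in the diagonal entry at \<open>v\<close>, so the task is to
  divide \<open>X v v\<close>. By homogeneity only vectors with value 1 at \<open>v\<close> matter:
  those on \<open>A\<close> bound the share \<open>\<alpha>\<close> from below, those on
  \<open>B\<close> from above. Gluing one of each to a vector on \<open>V\<close> shows that every
  lower bound is at most every upper bound.\<close>

lemma cut_vertex_splitting:
  assumes "finite V" "psd_on V X" "V = A \<union> B" "A \<inter> B = {v}"
    "\<And>i j. i \<in> A - {v} \<Longrightarrow> j \<in> B - {v} \<Longrightarrow> X i j = 0"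
  obtains \<alpha> where "psd_on A (\<lambda>i j. if i = v \<and> j = v then \<alpha> else X i j)"
    "psd_on B (\<lambda>i j. if i = v \<and> j = v then X v v - \<alpha> else X i j)"
proof -
  let ?X0 = "\<lambda>i j. if i = v \<and> j = v then 0 else X i j"
  have fin: "finite A" "finite B" using assms by auto
  have v: "v \<in> A" "v \<in> B" using assms(4) by auto
  note sym = psd_on_sym[OF assms(2)]
  \<comment> \<open>The least share that makes the piece on \<open>A\<close> positive
    semidefinite.\<close>
  define \<alpha> where "\<alpha> = Sup {- quad A ?X0 y |y. y v = 1}"
  have form: "quad W (\<lambda>i j. if i = v \<and> j = v then t else X i j) x = quad W ?X0 x + t * (x v)^2"
    if W: "v \<in> W" "finite W" for W t x
  proof -
    have "quad W (\<lambda>i j. if i = v \<and> j = v then t else X i j) x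
        = quad W (\<lambda>i j. ?X0 i j + (if i = v \<and> j = v then t else 0)) x"
      by (rule quad_cong) auto
    also have "\<dots> = quad W ?X0 x + quad W (\<lambda>i j. if i = v \<and> j = v then t else 0) x"
      by (rule quad_add_matrix)
    also have "quad W (\<lambda>i j. if i = v \<and> j = v then t else 0) x = quad {v} (\<lambda>i j. if i = v \<and> j = v then t else 0) x"
      by (rule quad_mono_neutral) (use W in auto)
    finally show ?thesis by (simp add: quad_def power2_eq_square)
  qed
  have joint: "- quad A ?X0 y \<le> X v v + quad B ?X0 z" if "y v = 1" "z v = 1" for y z
  proof -
    let ?x = "\<lambda>i. if i \<in> A then y i else z i"
    let ?XA = "\<lambda>i j. if i \<in> A \<and> j \<in> A then ?X0 i j else 0"
    let ?XB = "\<lambda>i j. if i \<in> B \<and> j \<in> B then ?X0 i j else 0"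
    have "0 \<le> quad V X ?x" by (rule psd_on_nonneg[OF assms(2)])
    also have "quad V X ?x = quad V (\<lambda>i j. if i = v \<and> j = v then X v v else X i j) ?x"
      by (rule quad_cong) auto
    also have "\<dots> = quad V ?X0 ?x + X v v"
      by (subst form) (use v assms that in auto)
    also have "quad V ?X0 ?x = quad V (\<lambda>i j. ?XA i j + ?XB i j) ?x"
    proof (rule quad_cong)
      fix i j assume "i \<in> V" "j \<in> V"
      moreover have "X i j = 0" "X j i = 0" if "i \<in> A - {v}" "j \<in> B - {v}" for i j
        using assms(5)[OF that] sym[of i j] that assms(3) by auto
      ultimately show "?X0 i j = ?XA i j + ?XB i j" using assms(3,4) by (auto split: if_splits)
    qed simp
    also have "\<dots> = quad V ?XA ?x + quad V ?XB ?x" by (rule quad_add_matrix)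
    also have "quad V ?XA ?x = quad A ?XA ?x" by (rule quad_mono_neutral) (use assms in auto)
    also have "\<dots> = quad A ?X0 y" by (rule quad_cong) auto
    also have "quad V ?XB ?x = quad B ?XB ?x" by (rule quad_mono_neutral) (use assms in auto)
    also have "\<dots> = quad B ?X0 z"
    proof (rule quad_cong)
      fix i assume "i \<in> B"
      then have "i \<in> A \<Longrightarrow> i = v" using assms(4) by auto
      then show "?x i = z i" using that by auto
    qed auto
    finally show ?thesis by simp
  qed
  have lower: "- quad A ?X0 y \<le> \<alpha>" if "y v = 1" for y
    unfolding \<alpha>_def
    by (rule cSup_upper) (use that joint[where z = "\<lambda>_. 1"] in \<open>auto intro!: bdd_aboveI\<close>)
  have upper: "\<alpha> \<le> X v v + quad B ?X0 z" if "z v = 1" for z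
    unfolding \<alpha>_def
    by (rule cSup_least) (use that joint in \<open>auto intro!: exI[of _ "\<lambda>_. 1"]\<close>)
  have psd: "psd_on W (\<lambda>i j. if i = v \<and> j = v then t else X i j)"
    if W: "v \<in> W" "W \<subseteq> V" and t: "\<And>y. y v = 1 \<Longrightarrow> 0 \<le> quad W ?X0 y + t" for W t
    unfolding psd_on_def
  proof (intro conjI ballI allI)
    fix i j assume "i \<in> W" "j \<in> W"
    then have "X i j = X j i" by (intro sym) (use W in auto)
    then show "(if i = v \<and> j = v then t else X i j) = (if j = v \<and> i = v then t else X j i)" by auto
  next
    fix x :: "'a \<Rightarrow> real"
    have finW: "finite W" using W assms(1) finite_subset by blast
    have *: "quad W (\<lambda>i j. if i = v \<and> j = v then t else X i j) x = quad W ?X0 x + t * (x v)^2"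
      by (rule form[OF W(1) finW])
    show "0 \<le> quad W (\<lambda>i j. if i = v \<and> j = v then t else X i j) x"
    \<comment> \<open>A vector vanishing at \<open>v\<close> cannot be normalised, but on it the
      changed diagonal entry has no effect and the form is that of \<open>X\<close>.\<close>
    proof (cases "x v = 0")
      case True
      have "quad W ?X0 x = quad W X x"
        unfolding quad_def by (intro sum.cong refl) (use True in auto)
      then show ?thesis
        using * True psd_on_nonneg[OF psd_on_subset[OF assms(1,2) W(2)], of x] by simp
    next
      case False
      have "quad W ?X0 x = quad W ?X0 (\<lambda>i. x v * (x i / x v))"
        by (rule quad_cong) (use False in auto)
      then have "quad W ?X0 x = (x v)^2 * quad W ?X0 (\<lambda>i. x i / x v)"
        by (simp only: quad_scale_vector)
      then have "quad W (\<lambda>i j. if i = v \<and> j = v then t else X i j) x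
          = (x v)^2 * (quad W ?X0 (\<lambda>i. x i / x v) + t)"
        unfolding * by (simp add: algebra_simps)
      then show ?thesis using t[of "\<lambda>i. x i / x v"] False by simp
    qed
  qed
  show ?thesis
  proof (rule that[of \<alpha>]; rule psd)
    show "0 \<le> quad A ?X0 y + \<alpha>" if "y v = 1" for y using lower[of y, OF that] by simp
    show "0 \<le> quad B ?X0 y + (X v v - \<alpha>)" if "y v = 1" for y using upper[of y, OF that] by simp
  qed (use v assms(3) in auto)
qed

section \<open>Graphs without long odd cycles\<close>

text \<open>The first vertex is not repeated at the end, so the length of the list is the number of
  edges. An edge walked back and forth has length 2 and distinct vertices; this is harmless, as only
  odd lengths are sought.\<close>

definition closed_walk :: "('a \<times> 'a) set \<Rightarrow> 'a list \<Rightarrow> bool" where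
  "closed_walk E xs \<longleftrightarrow> xs \<noteq> [] \<and> successively (\<lambda>u v. (u, v) \<in> E) xs \<and> (last xs, hd xs) \<in> E"

definition long_odd_cycle :: "('a \<times> 'a) set \<Rightarrow> bool" where
  "long_odd_cycle E \<longleftrightarrow> (\<exists>xs. closed_walk E xs \<and> distinct xs \<and> odd (length xs) \<and> 5 \<le> length xs)"

lemma closed_walk_mono: "closed_walk E xs \<Longrightarrow> E \<subseteq> F \<Longrightarrow> closed_walk F xs"
  unfolding closed_walk_def by (auto elim: successively_mono)

lemma long_odd_cycle_mono: "long_odd_cycle E \<Longrightarrow> E \<subseteq> F \<Longrightarrow> long_odd_cycle F"
  unfolding long_odd_cycle_def using closed_walk_mono by blast

text \<open>A repeated vertex splits the walk into two shorter closed walks whose lengths add up to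
  the original one, so one of them is odd.\<close>

lemma odd_closed_walk_imp_odd_cycle:
  assumes "closed_walk E xs" "odd (length xs)"
  shows "\<exists>ys. closed_walk E ys \<and> distinct ys \<and> odd (length ys)"
  using assms
proof (induction "length xs" arbitrary: xs rule: less_induct)
  case less
  show ?case
  proof (cases "distinct xs")
    case True
    then show ?thesis using less.prems by blast
  next
    case False
    then obtain as v bs cs where xs: "xs = as @ [v] @ bs @ [v] @ cs"
      using not_distinct_decomp by blast
    have *: "closed_walk E (v # bs)" "closed_walk E (as @ v # cs)"
      using less.prems(1) unfolding closed_walk_def xs
      by (auto simp: successively_append_iff successively_Cons hd_append last_append split: if_splits)
    have "length xs = length (v # bs) + length (as @ v # cs)" unfolding xs by simp
    then have "odd (length (v # bs)) \<or> odd (length (as @ v # cs))"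
      using less.prems(2) by auto
    then show ?thesis
      using less.hyps[of "v # bs"] less.hyps[of "as @ v # cs"] * unfolding xs by auto
  qed
qed

lemma relpow_odd_imp_closed_walk:
  assumes "(u, u) \<in> E ^^ n" "odd n"
  shows "\<exists>xs. closed_walk E xs \<and> odd (length xs)"
proof -
  obtain f where f: "f 0 = u" "f n = u" "\<And>i. i < n \<Longrightarrow> (f i, f (Suc i)) \<in> E"
    using assms(1) unfolding relpow_fun_conv by blast
  let ?xs = "map f [0..<n]"
  have "n > 0" using assms(2) by (rule odd_pos)
  have "(f (n - 1), f 0) \<in> E" using f(1,2) f(3)[of "n - 1"] \<open>n > 0\<close> by simp
  then have "closed_walk E ?xs"
    unfolding closed_walk_def using \<open>n > 0\<close> f(3)
    by (auto simp: successively_conv_nth hd_map last_map)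
  then show ?thesis using assms(2) by (intro exI[of _ ?xs]) auto
qed

text \<open>Colour a vertex by whether an even walk leads to it from the root of its component. An
  edge with equally coloured ends would close up to an odd closed walk through the root.\<close>

lemma two_colouring:
  assumes "sym E" "\<And>xs. closed_walk E xs \<Longrightarrow> distinct xs \<Longrightarrow> even (length xs)"
  shows "\<exists>c :: 'a \<Rightarrow> bool. \<forall>(u, v)\<in>E. c u \<noteq> c v"
proof -
  \<comment> \<open>Adjacent vertices are reachable from the same vertices, so the choice returns
    the same root for both.\<close>
  define root where "root v = (SOME w. (w, v) \<in> E\<^sup>*)" for v
  have root: "(root v, v) \<in> E\<^sup>*" for v
    unfolding root_def by (rule someI[of _ v]) simp
  have root_eq: "root u = root v" if "(u, v) \<in> E" for u v
  proof -
    have "(v, u) \<in> E" using that assms(1) by (auto dest: symD)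
    then have "(w, u) \<in> E\<^sup>* \<longleftrightarrow> (w, v) \<in> E\<^sup>*" for w
      using that by (meson rtrancl.rtrancl_into_rtrancl)
    then show ?thesis unfolding root_def by simp
  qed
  define c where "c v \<longleftrightarrow> (\<exists>n. even n \<and> (root v, v) \<in> E ^^ n)" for v
  have rev: "(v, u) \<in> E ^^ n" if "(u, v) \<in> E ^^ n" for u v n
    using that
  proof (induction n arbitrary: v)
    case (Suc n)
    then obtain w where "(u, w) \<in> E ^^ n" "(w, v) \<in> E" by auto
    then have "(w, u) \<in> E ^^ n" "(v, w) \<in> E" using Suc.IH assms(1) by (auto dest: symD)
    then show ?case by (rule relpow_Suc_I2[rotated])
  qed auto
  have "c u \<noteq> c v" if uv: "(u, v) \<in> E" for u v
  proof
    assume "c u = c v"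
    \<comment> \<open>If neither end has an even walk from the root, any walks to them are odd, so
      the parities agree in both cases.\<close>
    obtain m n where mn: "(root u, u) \<in> E ^^ m" "(root v, v) \<in> E ^^ n" "even m \<longleftrightarrow> even n"
    proof (cases "c u")
      case True
      then have "c v" using \<open>c u = c v\<close> by simp
      then show ?thesis using that True unfolding c_def by blast
    next
      case False
      then have "\<not> c v" using \<open>c u = c v\<close> by simp
      obtain m n where "(root u, u) \<in> E ^^ m" "(root v, v) \<in> E ^^ n"
        using root rtrancl_imp_relpow by metis
      then show ?thesis using that False \<open>\<not> c v\<close> unfolding c_def by blast
    qed
    have "(root u, v) \<in> E ^^ Suc m" using mn(1) uv by auto
    moreover have "(v, root u) \<in> E ^^ n" using rev[OF mn(2)] root_eq[OF uv] by simp
    ultimately have "(root u, root u) \<in> E ^^ (Suc m + n)"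
      unfolding relpow_add by auto
    then obtain xs where "closed_walk E xs" "odd (length xs)"
      using relpow_odd_imp_closed_walk mn(3) by (metis even_Suc even_add)
    then show False using odd_closed_walk_imp_odd_cycle assms(2) by blast
  qed
  then show ?thesis by (intro exI[of _ c]) auto
qed

text \<open>The path is cut back to the earlier visit when its new end already occurs. The clause on
  reachability keeps the path inside one component.\<close>

lemma rtrancl_imp_path:
  assumes "(y, z) \<in> E\<^sup>*"
  shows "\<exists>xs. xs \<noteq> [] \<and> distinct xs \<and> successively (\<lambda>u v. (u, v) \<in> E) xs \<and> hd xs = y \<and> last xs = z
    \<and> (\<forall>w\<in>set xs. (y, w) \<in> E\<^sup>*)"
  using assms
proof (induction rule: rtrancl_induct)
  case base
  then show ?case by (intro exI[of _ "[y]"]) auto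
next
  case (step w z)
  then obtain xs where xs: "xs \<noteq> []" "distinct xs" "successively (\<lambda>u v. (u, v) \<in> E) xs"
    "hd xs = y" "last xs = w" "\<forall>w\<in>set xs. (y, w) \<in> E\<^sup>*" by blast
  show ?case
  proof (cases "z \<in> set xs")
    case True
    then obtain as bs where as: "xs = as @ z # bs" by (meson split_list)
    then show ?thesis using xs
      by (intro exI[of _ "as @ [z]"]) (auto simp: successively_append_iff successively_Cons hd_append)
  next
    case False
    have "(y, z) \<in> E\<^sup>*" using step by auto
    then show ?thesis using xs False step
      by (intro exI[of _ "xs @ [z]"]) (auto simp: successively_append_iff)
  qed
qed

text \<open>Closing the path through the edge \<open>ba\<close> or through the two edges \<open>bc\<close>, \<open>ca\<close> produces cycles of both parities.\<close>

lemma triangle_path_imp_long_odd_cycle: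
  assumes "sym E" "(a, b) \<in> E" "(b, c) \<in> E" "(c, a) \<in> E" "distinct [a, b, c]"
    "xs \<noteq> []" "distinct xs" "successively (\<lambda>u v. (u, v) \<in> E) xs" "set xs \<inter> {a, b, c} = {}"
    "(a, hd xs) \<in> E" "(last xs, b) \<in> E" "2 \<le> length xs"
  shows "long_odd_cycle E"
proof (cases "odd (length xs)")
  case True
  have "(b, a) \<in> E" using assms(1,2) by (auto dest: symD)
  then have "closed_walk E (xs @ [b, a])"
    using assms unfolding closed_walk_def by (auto simp: successively_append_iff)
  \<comment> \<open>A path with a single vertex would only close up to another triangle; being odd
    and at least 2, the length is at least 3.\<close>
  moreover have "3 \<le> length xs" using True assms(12) by presburger
  ultimately show ?thesis using assms True
    unfolding long_odd_cycle_def by (intro exI[of _ "xs @ [b, a]"]) auto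
next
  case False
  have "closed_walk E (xs @ [b, c, a])"
    using assms unfolding closed_walk_def by (auto simp: successively_append_iff)
  then show ?thesis using assms False
    unfolding long_odd_cycle_def by (intro exI[of _ "xs @ [b, c, a]"]) auto
qed

text \<open>An odd cycle must be a triangle \<open>?T\<close>. Let \<open>C\<close> be a component
  of the rest. If at most one vertex of \<open>?T\<close> has neighbours in \<open>C\<close>, it
  cuts \<open>C\<close> off. If at least two have, all their neighbours in \<open>C\<close> are one
  vertex \<open>y\<close>, since a path in \<open>C\<close> between two distinct ones would give a
  long odd cycle; then either \<open>C\<close> is just \<open>y\<close>, which is simplicial, or
  \<open>y\<close> is a cut vertex.\<close>

lemma no_long_odd_cycle_cases:
  assumes "E \<subseteq> V \<times> V" "sym E" "irrefl E" "\<not> long_odd_cycle E"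
  obtains (bipartite) c :: "'a \<Rightarrow> bool" where "\<And>u v. (u, v) \<in> E \<Longrightarrow> c u \<noteq> c v"
    | (simplicial) i where "i \<in> V" "\<And>j k. (i, j) \<in> E \<Longrightarrow> (i, k) \<in> E \<Longrightarrow> j \<noteq> k \<Longrightarrow> (j, k) \<in> E"
    | (cut) A B v where "V = A \<union> B" "A \<inter> B = {v}" "A \<noteq> V" "B \<noteq> V"
      "\<And>i j. i \<in> A - {v} \<Longrightarrow> j \<in> B - {v} \<Longrightarrow> (i, j) \<notin> E"
proof (cases "\<exists>c :: 'a \<Rightarrow> bool. \<forall>(u, v)\<in>E. c u \<noteq> c v")
  case True
  then show ?thesis using bipartite by blast
next
  case False
  have E_sym: "(v, u) \<in> E" if "(u, v) \<in> E" for u v using assms(2) that by (auto dest: symD)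
  have E_irr: "(u, u) \<notin> E" for u using assms(3) by (auto simp: irrefl_def)
  obtain xs where xs: "closed_walk E xs" "distinct xs" "odd (length xs)"
    using two_colouring[OF assms(2)] False by blast
  \<comment> \<open>Length 5 or more is excluded by hypothesis and length 1 would be a loop, so only
    a triangle remains.\<close>
  have "length xs < 5" using xs assms(4) unfolding long_odd_cycle_def by (meson not_le)
  moreover have "length xs \<noteq> 1"
    using xs E_irr unfolding closed_walk_def by (auto simp: length_Suc_conv)
  ultimately have "length xs = 3" using xs(3) by presburger
  then obtain a b c where "xs = [a, b, c]" by (auto simp: length_Suc_conv numeral_3_eq_3)
  then have E_abc: "(a, b) \<in> E" "(b, c) \<in> E" "(c, a) \<in> E" and d_abc: "distinct [a, b, c]"
    using xs unfolding closed_walk_def by auto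
  let ?T = "{a, b, c}"
  have T_V: "?T \<subseteq> V" using E_abc assms(1) by auto
  have T_clique: "(p, q) \<in> E" if "p \<in> ?T" "q \<in> ?T" "p \<noteq> q" for p q
    using that E_abc E_sym by auto
  let ?U = "V - ?T"
  let ?F = "E \<inter> ?U \<times> ?U"
  have simplicial_if: thesis if "i \<in> V" "\<And>j. (i, j) \<in> E \<Longrightarrow> j \<in> ?T" for i
    by (rule simplicial[OF that(1)]) (use that(2) T_clique in blast)
  show thesis
  proof (cases "?U = {}")
    case True
    then show ?thesis using simplicial_if[of a] T_V assms(1) by auto
  next
    case False
    then obtain x where x: "x \<in> ?U" by blast
    define C where "C = {y. (x, y) \<in> ?F\<^sup>*}"
    have "x \<in> C" unfolding C_def by simp
    have C_U: "C \<subseteq> ?U"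
    proof
      fix y assume "y \<in> C"
      then have "(x, y) \<in> ?F\<^sup>*" unfolding C_def by simp
      then show "y \<in> ?U" by (cases rule: rtranclE) (use x in auto)
    qed
    have C_closed: "z \<in> C" if "y \<in> C" "(y, z) \<in> E" "z \<notin> ?T" for y z
    proof -
      have "(y, z) \<in> ?F" using that C_U assms(1) by auto
      then show ?thesis using that(1) unfolding C_def by (auto intro: rtrancl_into_rtrancl)
    qed
    have F_sym: "sym ?F" using assms(2) by (auto simp: sym_def)
    \<comment> \<open>Distinct attachment points \<open>y\<close> and \<open>z\<close> are joined by
      a path inside \<open>C\<close> with at least two vertices, which is what
      \<open>triangle_path_imp_long_odd_cycle\<close> needs; \<open>r\<close> is the third vertex of
      the triangle.\<close>
    have unique: "y = z" if pq: "p \<in> ?T" "q \<in> ?T" "p \<noteq> q" and yz: "y \<in> C" "z \<in> C" "(p, y) \<in> E" "(q, z) \<in> E"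
      for p q y z
    proof (rule ccontr)
      assume "y \<noteq> z"
      have "(y, x) \<in> ?F\<^sup>*" "(x, z) \<in> ?F\<^sup>*"
        using yz F_sym unfolding C_def by (auto intro: symD[OF sym_rtrancl])
      then have "(y, z) \<in> ?F\<^sup>*" by (rule rtrancl_trans)
      from rtrancl_imp_path[OF this] obtain ys where ys: "ys \<noteq> []" "distinct ys" "successively (\<lambda>u v. (u, v) \<in> ?F) ys" "hd ys = y"
        "last ys = z" "\<forall>w\<in>set ys. (y, w) \<in> ?F\<^sup>*"
        by blast
      have "set ys \<subseteq> C"
      proof
        fix w assume "w \<in> set ys"
        then have "(y, w) \<in> ?F\<^sup>*" using ys(6) by blast
        with yz(1) show "w \<in> C" unfolding C_def mem_Collect_eq by (rule rtrancl_trans)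
      qed
      have "(a \<noteq> p \<and> a \<noteq> q) \<or> (b \<noteq> p \<and> b \<noteq> q) \<or> (c \<noteq> p \<and> c \<noteq> q)" using d_abc by auto
      then obtain r where r: "r \<in> ?T" "r \<noteq> p" "r \<noteq> q" by blast
      have "?T = {p, q, r}" using pq r d_abc by auto
      have "long_odd_cycle E"
      proof (rule triangle_path_imp_long_odd_cycle[OF assms(2)])
        show "(p, q) \<in> E" "(q, r) \<in> E" "(r, p) \<in> E" using T_clique pq r by auto
        show "distinct [p, q, r]" using pq r by auto
        show "successively (\<lambda>u v. (u, v) \<in> E) ys" by (rule successively_mono[OF ys(3)]) auto
        show "set ys \<inter> {p, q, r} = {}"
          using \<open>set ys \<subseteq> C\<close> C_U unfolding \<open>?T = {p, q, r}\<close> by blast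
        show "(p, hd ys) \<in> E" using ys yz by simp
        show "(last ys, q) \<in> E" using ys yz E_sym by simp
        show "2 \<le> length ys"
        proof (rule ccontr)
          assume "\<not> 2 \<le> length ys"
          moreover have "0 < length ys" using ys(1) by simp
          ultimately have "length ys = 1" by linarith
          then show False using ys(4,5) \<open>y \<noteq> z\<close> by (auto simp: length_Suc_conv)
        qed
      qed (use ys in auto)
      then show False using assms(4) by simp
    qed
    let ?att = "{p \<in> ?T. \<exists>y\<in>C. (p, y) \<in> E}"
    show ?thesis
    proof (cases "\<exists>p\<in>?att. \<exists>q\<in>?att. p \<noteq> q")
      case False
      \<comment> \<open>\<open>?att\<close> may be empty, namely when \<open>C\<close> is a whole
        component of the graph; then any triangle vertex serves as \<open>v\<close>.\<close>
      then obtain v where v: "v \<in> ?T" "?att \<subseteq> {v}" by blast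
      show ?thesis
      proof (rule cut[of "insert v C" "V - C" v])
        show "V = insert v C \<union> (V - C)" "insert v C \<inter> (V - C) = {v}"
          using C_U T_V v(1) by auto
        show "V - C \<noteq> V" using \<open>x \<in> C\<close> x by blast
        obtain r where "r \<in> ?T" "r \<noteq> v" using d_abc by auto
        then show "insert v C \<noteq> V" using C_U T_V by blast
        show "(i, j) \<notin> E" if "i \<in> insert v C - {v}" "j \<in> V - C - {v}" for i j
        proof
          assume "(i, j) \<in> E"
          then have "j \<in> ?T" using C_closed that by blast
          then have "j \<in> ?att" using that E_sym[OF \<open>(i, j) \<in> E\<close>] by blast
          then show False using v that by blast
        qed
      qed
    next
      case True
      then obtain p q y z where pq: "p \<in> ?T" "q \<in> ?T" "p \<noteq> q" "y \<in> C" "z \<in> C" "(p, y) \<in> E" "(q, z) \<in> E"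
        by blast
      have "y = z" by (rule unique[OF pq])
      \<comment> \<open>\<open>unique\<close> needs two different triangle vertices: a neighbour of
        \<open>p\<close> is compared with that of \<open>q\<close>, any other with that of
        \<open>p\<close>.\<close>
      have att: "w = y" if "w \<in> C" "r \<in> ?T" "(r, w) \<in> E" for r w
      proof (cases "r = p")
        case True
        then show ?thesis using unique[of p q w z] pq that \<open>y = z\<close> by simp
      next
        case False
        then show ?thesis using unique[of r p w y] pq that by simp
      qed
      show ?thesis
      proof (cases "C = {y}")
        case True
        show ?thesis
        proof (rule simplicial_if[of y])
          show "y \<in> V" using C_U pq by auto
          show "j \<in> ?T" if "(y, j) \<in> E" for j
            using C_closed[OF pq(4) that] True E_irr that by auto
        qed
      next
        case False
        show ?thesis
        proof (rule cut[of C "insert y (V - C)" y])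
          show "V = C \<union> insert y (V - C)" "C \<inter> insert y (V - C) = {y}"
            using C_U pq by auto
          show "C \<noteq> V" using C_U T_V by blast
          show "insert y (V - C) \<noteq> V" using False pq C_U by blast
          show "(i, j) \<notin> E" if "i \<in> C - {y}" "j \<in> insert y (V - C) - {y}" for i j
          proof
            assume ij: "(i, j) \<in> E"
            then have "j \<in> ?T" using C_closed that by blast
            then show False using att[of i j] ij E_sym that by blast
          qed
        qed
      qed
    qed
  qed
qed

section \<open>Sufficiency: induction over the support, then diagonal factors\<close>

definition support_on :: "'a set \<Rightarrow> ('a \<Rightarrow> 'a \<Rightarrow> real) \<Rightarrow> ('a \<times> 'a) set" where
  "support_on V X = {(u, v). u \<in> V \<and> v \<in> V \<and> u \<noteq> v \<and> X u v \<noteq> 0}"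

lemma finite_support_on: "finite V \<Longrightarrow> finite (support_on V X)"
  by (rule finite_subset[of _ "V \<times> V"]) (auto simp: support_on_def)

text \<open>Vertex removal and cutting lower the number of vertices without adding support pairs,
  while edge removal lowers the support on the same vertices; hence the sum as measure. Smaller
  supports inherit the absence of long odd cycles.\<close>

lemma doubly_nonnegative_imp_completely_positive:
  assumes "finite V" "psd_on V X" "\<And>i j. i \<in> V \<Longrightarrow> j \<in> V \<Longrightarrow> 0 \<le> X i j"
    "\<not> long_odd_cycle (support_on V X)"
  shows "completely_positive V X"
  using assms
proof (induction "card V + card (support_on V X)" arbitrary: V X rule: less_induct)
  case less
  note fin = less.prems(1) and psd = less.prems(2) and nonneg = less.prems(3)
  let ?E = "support_on V X"
  have smaller: "completely_positive W Y"
    if "W \<subset> V" "psd_on W Y" "\<And>i j. i \<in> W \<Longrightarrow> j \<in> W \<Longrightarrow> 0 \<le> Y i j" "support_on W Y \<subseteq> ?E" for W Y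
  proof (rule less.hyps)
    have "card W < card V" using that(1) fin by (simp add: psubset_card_mono)
    moreover have "card (support_on W Y) \<le> card ?E"
      using that(4) fin by (simp add: card_mono finite_support_on)
    ultimately show "card W + card (support_on W Y) < card V + card ?E" by simp
    show "finite W" using that(1) fin by (meson finite_subset psubset_imp_subset)
    show "\<not> long_odd_cycle (support_on W Y)"
      using that(4) less.prems(4) long_odd_cycle_mono by blast
  qed (use that in auto)
  have "?E \<subseteq> V \<times> V" "sym ?E" "irrefl ?E"
    using psd_on_sym[OF psd] by (auto simp: support_on_def sym_def irrefl_def)
  from this less.prems(4) show ?case
  proof (cases rule: no_long_odd_cycle_cases)
    case (bipartite c)
    show ?thesis
      by (rule bipartite_completely_positive[OF fin psd nonneg, of c])
        (use bipartite in \<open>auto simp: support_on_def\<close>)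
  next
    case (simplicial i)
    have clique: "X j k \<noteq> 0" if "j \<in> V - {i}" "k \<in> V - {i}" "j \<noteq> k" "X i j \<noteq> 0" "X i k \<noteq> 0" for j k
      using simplicial(2)[of j k] simplicial(1) that by (auto simp: support_on_def)
    show ?thesis
    proof (rule simplicial_reduction[OF fin psd nonneg simplicial(1) clique])
      fix Y assume vertex: "psd_on (V - {i}) Y" "\<And>j k. j \<in> V - {i} \<Longrightarrow> k \<in> V - {i} \<Longrightarrow> 0 \<le> Y j k"
        "\<And>j k. j \<in> V - {i} \<Longrightarrow> k \<in> V - {i} \<Longrightarrow> j \<noteq> k \<Longrightarrow> X j k = 0 \<Longrightarrow> Y j k = 0"
        "completely_positive (V - {i}) Y \<Longrightarrow> completely_positive V X"
      have "completely_positive (V - {i}) Y"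
        by (rule smaller[OF _ vertex(1,2)]) (use simplicial(1) vertex(3) in \<open>auto simp: support_on_def\<close>)
      then show "completely_positive V X" by (rule vertex(4))
    next
      fix Y j k assume edge: "psd_on V Y" "\<And>j k. j \<in> V \<Longrightarrow> k \<in> V \<Longrightarrow> 0 \<le> Y j k"
        "\<And>j k. j \<in> V \<Longrightarrow> k \<in> V \<Longrightarrow> j \<noteq> k \<Longrightarrow> X j k = 0 \<Longrightarrow> Y j k = 0"
        "j \<in> V" "k \<in> V" "j \<noteq> k" "X j k \<noteq> 0" "Y j k = 0"
        "completely_positive V Y \<Longrightarrow> completely_positive V X"
      have "support_on V Y \<subset> ?E"
      proof
        show "support_on V Y \<subseteq> ?E" using edge(3) by (auto simp: support_on_def)
        have "(j, k) \<in> ?E" "(j, k) \<notin> support_on V Y" using edge(4-8) by (auto simp: support_on_def)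
        then show "support_on V Y \<noteq> ?E" by metis
      qed
      then have "card (support_on V Y) < card ?E"
        using fin by (simp add: psubset_card_mono finite_support_on)
      then have "completely_positive V Y"
        using \<open>support_on V Y \<subset> ?E\<close> less.prems(4) long_odd_cycle_mono
        by (intro less.hyps fin edge(1,2)) auto
      then show "completely_positive V X" by (rule edge(9))
    qed
  next
    case (cut A B v)
    have "X i j = 0" if "i \<in> A - {v}" "j \<in> B - {v}" for i j
      using cut(5)[OF that] cut(1,2) that by (auto simp: support_on_def)
    note cut_zero = this
    obtain \<alpha> where \<alpha>: "psd_on A (\<lambda>i j. if i = v \<and> j = v then \<alpha> else X i j)"
      "psd_on B (\<lambda>i j. if i = v \<and> j = v then X v v - \<alpha> else X i j)"
      using cut_vertex_splitting[OF fin psd cut(1,2) cut_zero] by blast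
    have piece: "completely_positive V (\<lambda>i j. if i \<in> W \<and> j \<in> W then (if i = v \<and> j = v then t else X i j) else 0)"
      if W: "W \<subset> V" "v \<in> W" and psdW: "psd_on W (\<lambda>i j. if i = v \<and> j = v then t else X i j)" for W t
    proof -
      let ?Y = "\<lambda>i j. if i = v \<and> j = v then t else X i j"
      have "finite W" using W fin by (meson finite_subset psubset_imp_subset)
      \<comment> \<open>The division of \<open>X v v\<close> alone does not give the sign of the
        shares; each is nonnegative as a diagonal entry of a positive semidefinite piece.\<close>
      have "0 \<le> t" using psd_on_diag_nonneg[OF \<open>finite W\<close> psdW W(2)] by simp
      have "completely_positive W ?Y"
        by (rule smaller[OF W(1) psdW]) (use W nonneg \<open>0 \<le> t\<close> in \<open>auto simp: support_on_def\<close>)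
      then have "completely_positive W (\<lambda>i j. if i \<in> W \<and> j \<in> W then ?Y i j else 0)"
        by (rule completely_positive_cong) auto
      then show ?thesis
        by (rule completely_positive_extend) (use W in auto)
    qed
    have v: "v \<in> A" "v \<in> B" using cut(2) by auto
    have "A \<subset> V" "B \<subset> V" using cut by auto
    from completely_positive_add[OF piece[OF this(1) v(1) \<alpha>(1)] piece[OF this(2) v(2) \<alpha>(2)]]
    show ?thesis
    proof (rule completely_positive_cong)
      fix i j assume ij: "i \<in> V" "j \<in> V"
      have "X i j = 0" "X j i = 0" if "i \<in> A - {v}" "j \<in> B - {v}" for i j
        using cut_zero[OF that] psd_on_sym[OF psd, of i j] that cut(1) by auto
      then show "(if i \<in> A \<and> j \<in> A then (if i = v \<and> j = v then \<alpha> else X i j) else 0)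
        + (if i \<in> B \<and> j \<in> B then (if i = v \<and> j = v then X v v - \<alpha> else X i j) else 0) = X i j"
        using ij cut(1,2) by (auto split: if_splits)
    qed
  qed
qed

text \<open>The values at \<open>i\<close> of all listed vectors form the diagonal of
  \<open>P i\<close>; traces of products of diagonal matrices are then the required sums.\<close>

lemma completely_positive_imp_cpsd:
  assumes "completely_positive {1..n} X"
  shows "cpsd n X"
proof -
  obtain bs where bs: "\<forall>b\<in>set bs. \<forall>i. 0 \<le> b i" "\<forall>i\<in>{1..n}. \<forall>j\<in>{1..n}. X i j = (\<Sum>b\<leftarrow>bs. b i * b j)"
    using assms unfolding completely_positive_def by blast
  \<comment> \<open>One extra zero coordinate guarantees \<open>d \<ge> 1\<close> even for the empty
    list.\<close>
  define d where "d = Suc (length bs)"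
  define \<beta> where "\<beta> k i = (if k < length bs then (bs ! k) i else 0)" for k i
  have \<beta>: "0 \<le> \<beta> k i" for k i using bs(1) unfolding \<beta>_def by auto
  define P where "P i k l = (if k = l then complex_of_real (\<beta> k i) else 0)" for i k l
  have "hermitian_psd d (P i)" for i
    unfolding hermitian_psd_def hermitian_def
  proof (intro conjI allI impI)
    fix w :: "nat \<Rightarrow> complex"
    have "(\<Sum>k<d. \<Sum>l<d. cnj (w k) * P i k l * w l) = (\<Sum>k<d. complex_of_real (\<beta> k i * (cmod (w k))^2))"
    proof (rule sum.cong[OF refl])
      fix k assume "k \<in> {..<d}"
      have "(\<Sum>l<d. cnj (w k) * P i k l * w l) = (\<Sum>l<d. if k = l then \<beta> k i * (w k * cnj (w k)) else 0)"
        by (intro sum.cong) (auto simp: P_def)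
      then show "(\<Sum>l<d. cnj (w k) * P i k l * w l) = complex_of_real (\<beta> k i * (cmod (w k))^2)"
        using \<open>k \<in> {..<d}\<close> by (simp add: complex_norm_square del: of_real_power)
    qed
    then show "0 \<le> Re (\<Sum>k<d. \<Sum>l<d. cnj (w k) * P i k l * w l)"
      using \<beta> by (simp add: sum_nonneg)
  qed (auto simp: P_def)
  moreover have "complex_of_real (X i j) = trace_prod d (P i) (P j)" if "i \<in> {1..n}" "j \<in> {1..n}" for i j
  proof -
    have "trace_prod d (P i) (P j) = (\<Sum>k<d. complex_of_real (\<beta> k i * \<beta> k j))"
      unfolding trace_prod_def
    proof (rule sum.cong[OF refl])
      fix k assume "k \<in> {..<d}"
      have "(\<Sum>l<d. P i k l * P j l k) = (\<Sum>l<d. if k = l then complex_of_real (\<beta> k i * \<beta> k j) else 0)"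
        by (intro sum.cong) (auto simp: P_def)
      then show "(\<Sum>l<d. P i k l * P j l k) = complex_of_real (\<beta> k i * \<beta> k j)"
        using \<open>k \<in> {..<d}\<close> by simp
    qed
    also have "\<dots> = complex_of_real (\<Sum>k<length bs. (bs ! k) i * (bs ! k) j)"
      unfolding d_def by (simp add: \<beta>_def)
    also have "(\<Sum>k<length bs. (bs ! k) i * (bs ! k) j) = X i j"
      using bs(2) that by (simp add: sum_list_sum_nth atLeast0LessThan)
    finally show ?thesis by simp
  qed
  ultimately show ?thesis unfolding cpsd_def by (intro exI[of _ d] conjI exI[of _ P]) (auto simp: d_def)
qed

section \<open>Spectral decomposition of real symmetric matrices\<close>

definition inner_on :: "'a set \<Rightarrow> ('a \<Rightarrow> real) \<Rightarrow> ('a \<Rightarrow> real) \<Rightarrow> real" where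
  "inner_on I x y = (\<Sum>i\<in>I. x i * y i)"

definition frob :: "'a set \<Rightarrow> ('a \<Rightarrow> 'a \<Rightarrow> real) \<Rightarrow> ('a \<Rightarrow> 'a \<Rightarrow> real) \<Rightarrow> real" where
  "frob I A B = (\<Sum>i\<in>I. \<Sum>j\<in>I. A i j * B i j)"

definition mat_apply :: "'a set \<Rightarrow> ('a \<Rightarrow> 'a \<Rightarrow> real) \<Rightarrow> ('a \<Rightarrow> real) \<Rightarrow> 'a \<Rightarrow> real" where
  "mat_apply I A x i = inner_on I (A i) x"

definition orthonormal_on :: "'a set \<Rightarrow> 'k set \<Rightarrow> ('k \<Rightarrow> 'a \<Rightarrow> real) \<Rightarrow> bool" where
  "orthonormal_on I K e \<longleftrightarrow> (\<forall>k\<in>K. \<forall>l\<in>K. inner_on I (e k) (e l) = of_bool (k = l))"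

lemma inner_on_commute: "inner_on I x y = inner_on I y x"
  by (simp add: inner_on_def mult.commute)

lemma inner_on_self_nonneg: "0 \<le> inner_on I x x"
  by (simp add: inner_on_def sum_nonneg)

lemma inner_on_self_zero: "finite I \<Longrightarrow> inner_on I x x = 0 \<Longrightarrow> i \<in> I \<Longrightarrow> x i = 0"
  unfolding inner_on_def by (subst (asm) sum_nonneg_eq_0_iff) auto

lemma inner_on_add_left: "inner_on I (\<lambda>i. x i + y i) z = inner_on I x z + inner_on I y z"
  by (simp add: inner_on_def algebra_simps sum.distrib)

lemma inner_on_diff_left: "inner_on I (\<lambda>i. x i - y i) z = inner_on I x z - inner_on I y z"
  by (simp add: inner_on_def algebra_simps sum_subtractf)

lemma inner_on_scale_left: "inner_on I (\<lambda>i. c * x i) z = c * inner_on I x z"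
  by (simp add: inner_on_def algebra_simps sum_distrib_left)

lemma inner_on_diff_self:
  "inner_on I (\<lambda>i. x i - y i) (\<lambda>i. x i - y i) = inner_on I x x - 2 * inner_on I y x + inner_on I y y"
  by (simp add: inner_on_def algebra_simps sum.distrib sum_subtractf sum_distrib_left)

lemma inner_on_scale_self: "inner_on I (\<lambda>i. c * x i) (\<lambda>i. c * x i) = c\<^sup>2 * inner_on I x x"
  by (simp add: inner_on_def power2_eq_square algebra_simps sum_distrib_left)

lemma inner_on_sum_left: "inner_on I (\<lambda>i. \<Sum>k\<in>K. x k i) z = (\<Sum>k\<in>K. inner_on I (x k) z)"
  by (simp add: inner_on_def sum_distrib_right) (rule sum.swap)

lemma inner_on_cong:
  "(\<And>i. i \<in> I \<Longrightarrow> x i = x' i) \<Longrightarrow> (\<And>i. i \<in> I \<Longrightarrow> y i = y' i) \<Longrightarrow> inner_on I x y = inner_on I x' y'"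
  unfolding inner_on_def by (intro sum.cong) auto

lemma quad_eq_inner_on: "quad I A x = inner_on I x (mat_apply I A x)"
  by (simp add: quad_def inner_on_def mat_apply_def sum_distrib_left mult.assoc)

lemma frob_eq_sum_inner_on: "frob I A B = (\<Sum>i\<in>I. inner_on I (A i) (B i))"
  by (simp add: frob_def inner_on_def)

text \<open>Expand the squared norm of \<open>x - ?y\<close>, where \<open>?y\<close> is the
  projection of \<open>x\<close> onto the span of the \<open>e k\<close>.\<close>

lemma bessel:
  assumes "finite K" "orthonormal_on I K e"
  shows "(\<Sum>k\<in>K. (inner_on I x (e k))\<^sup>2) \<le> inner_on I x x"
proof -
  let ?c = "\<lambda>k. inner_on I x (e k)"
  let ?y = "\<lambda>i. \<Sum>k\<in>K. ?c k * e k i"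
  have ye: "inner_on I ?y (e l) = ?c l" if "l \<in> K" for l
  proof -
    have "inner_on I ?y (e l) = (\<Sum>k\<in>K. ?c k * inner_on I (e k) (e l))"
      by (simp add: inner_on_sum_left inner_on_scale_left)
    also have "\<dots> = (\<Sum>k\<in>K. if k = l then ?c k else 0)"
      by (intro sum.cong) (use assms(2) that in \<open>auto simp: orthonormal_on_def\<close>)
    finally show ?thesis using assms(1) that by simp
  qed
  have expand: "inner_on I ?y z = (\<Sum>k\<in>K. ?c k * inner_on I (e k) z)" for z
    by (simp only: inner_on_sum_left inner_on_scale_left)
  have "inner_on I ?y ?y = (\<Sum>k\<in>K. ?c k * ?c k)"
    unfolding expand[of ?y] by (intro sum.cong refl) (simp only: inner_on_commute[of I "e _" ?y] ye)
  moreover have "inner_on I ?y x = (\<Sum>k\<in>K. ?c k * ?c k)"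
    unfolding expand[of x] by (intro sum.cong refl) (simp only: inner_on_commute[of I "e _" x])
  ultimately show ?thesis
    using inner_on_self_nonneg[of I "\<lambda>i. x i - ?y i"] inner_on_diff_self[of I x ?y]
    by (simp add: power2_eq_square)
qed

text \<open>Sum Bessel's inequality over the coordinate vectors. This caps the size of orthonormal
  eigenvector families, so that a largest one exists.\<close>

lemma orthonormal_on_card_le:
  assumes "finite I" "finite K" "orthonormal_on I K e"
  shows "card K \<le> card I"
proof -
  have "(\<Sum>k\<in>K. (e k i)\<^sup>2) \<le> 1" if "i \<in> I" for i
  proof -
    have "inner_on I (\<lambda>j. of_bool (j = i)) (y :: 'a \<Rightarrow> real) = y i" for y
    proof -
      have "inner_on I (\<lambda>j. of_bool (j = i)) y = (\<Sum>j\<in>I. if j = i then y j else 0)"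
        unfolding inner_on_def by (intro sum.cong) auto
      then show ?thesis using assms(1) that by simp
    qed
    then show ?thesis using bessel[OF assms(2,3), of "\<lambda>j. of_bool (j = i)"] by simp
  qed
  then have "(\<Sum>i\<in>I. \<Sum>k\<in>K. (e k i)\<^sup>2) \<le> card I"
    using sum_mono[of I "\<lambda>i. \<Sum>k\<in>K. (e k i)\<^sup>2" "\<lambda>_. 1"] by simp
  also have "(\<Sum>i\<in>I. \<Sum>k\<in>K. (e k i)\<^sup>2) = (\<Sum>k\<in>K. inner_on I (e k) (e k))"
    unfolding inner_on_def power2_eq_square by (rule sum.swap)
  also have "\<dots> = card K" using assms(3) by (simp add: orthonormal_on_def)
  finally show ?thesis by simp
qed

text \<open>Tychonoff's theorem. Vectors are functions on the whole type, so compactness has to come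
  from the product topology.\<close>

lemma compact_box:
  fixes S :: "'a \<Rightarrow> real set"
  assumes "\<And>i. compact (S i)"
  shows "compact {x. \<forall>i. x i \<in> S i}"
proof -
  have "compactin (product_topology (\<lambda>_::'a. euclidean) UNIV) (PiE UNIV S)"
    using assms by (simp add: compactin_PiE)
  then show ?thesis by (simp add: euclidean_product_topology PiE_UNIV_domain Pi_def)
qed

text \<open>Let \<open>\<mu>\<close> be the maximum of the form on the unit ball, attained at
  \<open>y\<close>. Then \<open>\<mu>\<close> times the identity minus \<open>D\<close> is positive
  semidefinite with a zero at \<open>y\<close>, and \<open>psd_on_kernel\<close> is the eigenvalue
  equation.\<close>

lemma positive_quad_imp_eigenvector:
  assumes "finite I" "\<And>i j. i \<in> I \<Longrightarrow> j \<in> I \<Longrightarrow> D i j = D j i" "0 < quad I D x"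
  shows "\<exists>\<mu> y. \<mu> > 0 \<and> inner_on I y y = 1 \<and> (\<forall>i\<in>I. mat_apply I D y i = \<mu> * y i)"
proof -
  \<comment> \<open>Coordinates outside \<open>I\<close> are frozen at 0 and the others confined to
    \<open>[-1, 1]\<close>, so that the ball is a closed part of a compact box.\<close>
  define S where "S = {x. \<forall>i. x i \<in> (if i \<in> I then {-1..1} else {0::real})} \<inter> {x. inner_on I x x \<le> 1}"
  have cont: "continuous_on UNIV (\<lambda>x. x i)" for i :: 'a
    by (rule continuous_on_product_coordinates)
  have "compact S" unfolding S_def
    by (intro compact_Int_closed compact_box closed_Collect_le)
       (auto simp: inner_on_def intro!: continuous_intros cont)
  have normalise: "\<exists>z\<in>S. quad I D x = inner_on I x x * quad I D z" for x
  proof (cases "inner_on I x x = 0")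
    case True
    then have "x i = 0" if "i \<in> I" for i using inner_on_self_zero assms(1) that by metis
    then have "quad I D x = 0" by (simp add: quad_def)
    moreover have "(\<lambda>_. 0) \<in> S" by (auto simp: S_def inner_on_def)
    ultimately show ?thesis using True by (intro bexI[of _ "\<lambda>_. 0"]) auto
  next
    case False
    then have pos: "0 < inner_on I x x" using inner_on_self_nonneg[of I x] by linarith
    define r where "r = sqrt (inner_on I x x)"
    have r: "r > 0" "r\<^sup>2 = inner_on I x x" using pos by (auto simp: r_def)
    define z where "z = (\<lambda>i. if i \<in> I then x i / r else 0)"
    have "inner_on I z z = inner_on I (\<lambda>i. (1 / r) * x i) (\<lambda>i. (1 / r) * x i)"
      by (rule inner_on_cong) (auto simp: z_def)
    also have "\<dots> = 1"
      unfolding inner_on_scale_self r(2)[symmetric] using r(1) by (simp add: power_one_over)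
    finally have zz: "inner_on I z z = 1" .
    have "-1 \<le> z i \<and> z i \<le> 1" if "i \<in> I" for i
    proof -
      have "z i * z i \<le> inner_on I z z"
        unfolding inner_on_def using assms(1) that by (intro member_le_sum) auto
      then have "(z i)\<^sup>2 \<le> 1" unfolding power2_eq_square zz .
      then have "\<bar>z i\<bar> \<le> 1" by (simp only: abs_square_le_1)
      then show ?thesis by linarith
    qed
    moreover have "z i = 0" if "i \<notin> I" for i using that by (simp add: z_def)
    ultimately have "z \<in> S" using zz by (auto simp: S_def)
    moreover have "quad I D x = quad I D (\<lambda>i. r * z i)"
      by (rule quad_cong) (use r in \<open>auto simp: z_def\<close>)
    ultimately show ?thesis
      using r(2) by (intro bexI[of _ z]) (auto simp: quad_scale_vector)
  qed
  have "S \<noteq> {}" using normalise by blast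
  have "continuous_on S (quad I D)"
    unfolding quad_def by (intro continuous_intros continuous_on_subset[OF cont]) auto
  from continuous_attains_sup[OF \<open>compact S\<close> \<open>S \<noteq> {}\<close> this]
  obtain y where y: "y \<in> S" "\<And>z. z \<in> S \<Longrightarrow> quad I D z \<le> quad I D y" by blast
  define \<mu> where "\<mu> = quad I D y"
  have bound: "quad I D z \<le> \<mu> * inner_on I z z" for z
  proof -
    obtain w where "w \<in> S" "quad I D z = inner_on I z z * quad I D w" using normalise by blast
    then show ?thesis
      using mult_left_mono[OF y(2)[OF \<open>w \<in> S\<close>] inner_on_self_nonneg[of I z]]
      by (simp add: \<mu>_def mult.commute)
  qed
  have "\<mu> > 0" using bound[of x] assms(3) inner_on_self_nonneg[of I x]
    by (smt (verit) mult_nonpos_nonneg)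
  have yy: "inner_on I y y \<le> 1" using y(1) by (auto simp: S_def)
  \<comment> \<open>The maximum was taken over the ball; being positive, it can only be attained on
    the sphere.\<close>
  have "\<mu> \<le> \<mu> * inner_on I y y" using bound[of y] by (simp add: \<mu>_def)
  then have y1: "inner_on I y y = 1" using yy \<open>\<mu> > 0\<close> by simp
  let ?M = "\<lambda>i j. \<mu> * of_bool (i = j) + (- 1) * D i j"
  have id_row: "(\<Sum>j\<in>I. of_bool (i = j) * z j) = z i" if "i \<in> I" for i and z :: "'a \<Rightarrow> real"
  proof -
    have "(\<Sum>j\<in>I. of_bool (i = j) * z j) = (\<Sum>j\<in>I. if i = j then z j else 0)"
      by (intro sum.cong) auto
    then show ?thesis using assms(1) that by simp
  qed
  have "quad I (\<lambda>i j. of_bool (i = j)) z = inner_on I z z" for z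
    unfolding quad_eq_inner_on by (rule inner_on_cong) (auto simp: mat_apply_def inner_on_def id_row)
  then have quadM: "quad I ?M z = \<mu> * inner_on I z z - quad I D z" for z
    unfolding quad_add_matrix quad_scale_matrix by simp
  have "psd_on I ?M"
    unfolding psd_on_def quadM using bound assms(2) by auto
  moreover have "quad I ?M y = 0" unfolding quadM y1 by (simp add: \<mu>_def)
  ultimately have ker: "(\<Sum>j\<in>I. ?M i j * y j) = 0" if "i \<in> I" for i
    using psd_on_kernel[OF assms(1)] that by blast
  have "mat_apply I D y i = \<mu> * y i" if "i \<in> I" for i
  proof -
    have "(\<Sum>j\<in>I. ?M i j * y j) = \<mu> * (\<Sum>j\<in>I. of_bool (i = j) * y j) - mat_apply I D y i"
      unfolding mat_apply_def inner_on_def sum_distrib_left sum_subtractf[symmetric]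
      by (intro sum.cong) (auto simp: algebra_simps)
    then show ?thesis using ker[OF that] id_row[OF that] by simp
  qed
  then show ?thesis using \<open>\<mu> > 0\<close> y1 by blast
qed

text \<open>If the form vanished identically, \<open>D\<close> would be positive semidefinite with
  zero diagonal, hence zero. Otherwise the form of \<open>D\<close> or of \<open>- D\<close> is
  positive somewhere.\<close>

lemma nonzero_symmetric_eigenvector:
  assumes "finite I" "\<And>i j. i \<in> I \<Longrightarrow> j \<in> I \<Longrightarrow> D i j = D j i" "\<exists>i\<in>I. \<exists>j\<in>I. D i j \<noteq> 0"
  shows "\<exists>\<mu> y. \<mu> \<noteq> 0 \<and> inner_on I y y = 1 \<and> (\<forall>i\<in>I. mat_apply I D y i = \<mu> * y i)"
proof -
  have "\<exists>x. quad I D x \<noteq> 0"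
  proof (rule ccontr)
    assume "\<nexists>x. quad I D x \<noteq> 0"
    then have zero: "quad I D x = 0" for x by blast
    then have psd: "psd_on I D" using assms(2) by (auto simp: psd_on_def)
    have "D i i = 0" if "i \<in> I" for i
      using quad_unit[OF assms(1) that, of D 1] zero by simp
    then show False using psd_on_zero_diag[OF assms(1) psd] assms(3) by blast
  qed
  then obtain x where "quad I D x > 0 \<or> quad I D x < 0" by (meson linorder_neqE_linordered_idom)
  then show ?thesis
  proof
    assume "quad I D x > 0"
    from positive_quad_imp_eigenvector[OF assms(1,2) this] show ?thesis
      by (metis less_irrefl)
  next
    assume "quad I D x < 0"
    then have "quad I (\<lambda>i j. (- 1) * D i j) x > 0" unfolding quad_scale_matrix by simp
    from positive_quad_imp_eigenvector[OF assms(1) _ this]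
    obtain \<mu> y where "\<mu> > 0" "inner_on I y y = 1" "\<forall>i\<in>I. mat_apply I (\<lambda>i j. (- 1) * D i j) y i = \<mu> * y i"
      using assms(2) by auto
    moreover have "mat_apply I (\<lambda>i j. (- 1) * D i j) y i = - mat_apply I D y i" for i
      unfolding mat_apply_def inner_on_scale_left by simp
    ultimately show ?thesis
      by (intro exI[of _ "- \<mu>"] exI[of _ y]) (auto simp: minus_equation_iff)
  qed
qed

text \<open>Take a largest orthonormal family of eigenvectors. If the remainder \<open>?R\<close>
  were nonzero, it would have an eigenvector \<open>y\<close> for some
  \<open>\<mu> \<noteq> 0\<close>. As \<open>?R\<close> is symmetric and kills the family,
  \<open>y\<close> is orthogonal to the family, hence an eigenvector of \<open>D\<close> that
  enlarges it.\<close>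

lemma spectral_decomposition:
  assumes "finite I" "\<And>i j. i \<in> I \<Longrightarrow> j \<in> I \<Longrightarrow> D i j = D j i"
  shows "\<exists>(r::nat) e l. orthonormal_on I {..<r} e
    \<and> (\<forall>k<r. \<forall>i\<in>I. mat_apply I D (e k) i = l k * e k i)
    \<and> (\<forall>i\<in>I. \<forall>j\<in>I. D i j = (\<Sum>k<r. l k * e k i * e k j))"
proof -
  define Q where "Q r e l \<longleftrightarrow> orthonormal_on I {..<r} e
    \<and> (\<forall>k<r. \<forall>i\<in>I. mat_apply I D (e k) i = l k * e k i)" for r :: nat and e l
  have "Q 0 undefined undefined" by (auto simp: Q_def orthonormal_on_def)
  then have "\<exists>e l. Q 0 e l" by blast
  moreover have "r \<le> card I" if "\<exists>e l. Q r e l" for r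
    using that orthonormal_on_card_le[OF assms(1), of "{..<r}"] by (auto simp: Q_def)
  ultimately obtain r where r: "\<exists>e l. Q r e l" and max: "\<And>s. \<exists>e l. Q s e l \<Longrightarrow> s \<le> r"
    using Nat.ex_has_greatest_nat[of "\<lambda>r. \<exists>e l. Q r e l" 0 "card I"] by blast
  then obtain e l where el: "Q r e l" by blast
  have ortho: "orthonormal_on I {..<r} e" and eig: "\<And>k i. k < r \<Longrightarrow> i \<in> I \<Longrightarrow> mat_apply I D (e k) i = l k * e k i"
    using el by (auto simp: Q_def)
  let ?R = "\<lambda>i j. D i j - (\<Sum>k<r. l k * e k i * e k j)"
  have R_apply: "mat_apply I ?R x i = mat_apply I D x i - (\<Sum>k<r. l k * e k i * inner_on I (e k) x)" for x i
    by (simp add: mat_apply_def inner_on_diff_left inner_on_sum_left inner_on_scale_left)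
  have "\<not> (\<exists>i\<in>I. \<exists>j\<in>I. ?R i j \<noteq> 0)"
  proof
    assume "\<exists>i\<in>I. \<exists>j\<in>I. ?R i j \<noteq> 0"
    from nonzero_symmetric_eigenvector[OF assms(1) _ this]
    obtain \<mu> y where \<mu>: "\<mu> \<noteq> 0" and yy: "inner_on I y y = 1" and y: "\<And>i. i \<in> I \<Longrightarrow> mat_apply I ?R y i = \<mu> * y i"
      using assms(2) by (auto simp: mult.commute mult.left_commute)
    have ye: "inner_on I y (e k) = 0" if "k < r" for k
    proof -
      have "mat_apply I ?R (e k) i = 0" if "i \<in> I" for i
      proof -
        have "(\<Sum>m<r. l m * e m i * inner_on I (e m) (e k)) = (\<Sum>m<r. if m = k then l m * e m i else 0)"
          by (intro sum.cong) (use ortho \<open>k < r\<close> in \<open>auto simp: orthonormal_on_def\<close>)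
        then show ?thesis unfolding R_apply using eig[OF \<open>k < r\<close> that] \<open>k < r\<close> by simp
      qed
      then have "inner_on I (mat_apply I ?R (e k)) y = 0" by (simp add: inner_on_def)
      also have "inner_on I (mat_apply I ?R (e k)) y = inner_on I (e k) (mat_apply I ?R y)"
        unfolding inner_on_def mat_apply_def sum_distrib_left sum_distrib_right
        by (subst sum.swap) (intro sum.cong refl, simp add: assms(2) mult.commute mult.left_commute)
      also have "\<dots> = inner_on I (e k) (\<lambda>i. \<mu> * y i)" by (rule inner_on_cong) (auto simp: y)
      also have "\<dots> = \<mu> * inner_on I y (e k)" by (subst inner_on_commute) (rule inner_on_scale_left)
      finally show ?thesis using \<mu> by simp
    qed
    have "mat_apply I D y i = \<mu> * y i" if "i \<in> I" for i
      using y[OF that] unfolding R_apply by (simp add: inner_on_commute[of I "e _" y] ye)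
    then have "Q (Suc r) (e(r := y)) (l(r := \<mu>))"
      using ortho eig ye yy
      by (auto simp: Q_def orthonormal_on_def less_Suc_eq inner_on_commute[of I "e _" y])
    then show False using max[of "Suc r"] by auto
  qed
  then have "D i j = (\<Sum>k<r. l k * e k i * e k j)" if "i \<in> I" "j \<in> I" for i j using that by auto
  then show ?thesis using ortho eig by (intro exI[of _ r] exI[of _ e] exI[of _ l]) blast
qed

section \<open>Almost orthogonal positive matrices\<close>

lemma frob_commute: "frob I A B = frob I B A"
  by (simp add: frob_def mult.commute)

lemma frob_self_nonneg: "0 \<le> frob I A A"
  by (simp add: frob_def sum_nonneg)

lemma frob_add_left: "frob I (\<lambda>i j. A i j + B i j) C = frob I A C + frob I B C"
  by (simp add: frob_def algebra_simps sum.distrib)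

lemma frob_scale_left: "frob I (\<lambda>i j. c * A i j) C = c * frob I A C"
  by (simp add: frob_def algebra_simps sum_distrib_left)

lemma frob_sum_left: "frob I (\<lambda>i j. \<Sum>k\<in>K. A k i j) C = (\<Sum>k\<in>K. frob I (A k) C)"
proof -
  have "frob I (\<lambda>i j. \<Sum>k\<in>K. A k i j) C = (\<Sum>i\<in>I. \<Sum>k\<in>K. \<Sum>j\<in>I. A k i j * C i j)"
    unfolding frob_def sum_distrib_right by (intro sum.cong refl sum.swap)
  also have "\<dots> = (\<Sum>k\<in>K. frob I (A k) C)"
    unfolding frob_def by (rule sum.swap)
  finally show ?thesis .
qed

lemma frob_cong:
  "(\<And>i j. i \<in> I \<Longrightarrow> j \<in> I \<Longrightarrow> A i j = A' i j) \<Longrightarrow> (\<And>i j. i \<in> I \<Longrightarrow> j \<in> I \<Longrightarrow> B i j = B' i j)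
    \<Longrightarrow> frob I A B = frob I A' B'"
  unfolding frob_def by (intro sum.cong refl) auto

lemma frob_rank1: "frob I (\<lambda>i j. x i * x j) B = quad I B x"
  by (simp add: frob_def quad_def algebra_simps)

lemma sum_prod_le_sqrt:
  fixes a b :: "'k \<Rightarrow> real"
  shows "\<bar>\<Sum>k\<in>K. a k * b k\<bar> \<le> sqrt (\<Sum>k\<in>K. (a k)\<^sup>2) * sqrt (\<Sum>k\<in>K. (b k)\<^sup>2)"
  using real_sqrt_le_mono[OF Cauchy_Schwarz_ineq_sum[of a b K]] by (simp add: real_sqrt_mult)

lemma frob_cauchy_schwarz: "\<bar>frob I A B\<bar> \<le> sqrt (frob I A A) * sqrt (frob I B B)"
  using sum_prod_le_sqrt[of "\<lambda>(i, j). A i j" "\<lambda>(i, j). B i j" "I \<times> I"]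
  by (simp add: frob_def sum.cartesian_product case_prod_unfold power2_eq_square)

lemma psd_on_rank1_sum:
  assumes "finite K" "\<And>k. k \<in> K \<Longrightarrow> 0 \<le> l k"
  shows "psd_on I (\<lambda>i j. \<Sum>k\<in>K. l k * e k i * e k j)"
proof -
  have quad: "quad I (\<lambda>i j. \<Sum>k\<in>K. l k * e k i * e k j) x = (\<Sum>k\<in>K. l k * (\<Sum>i\<in>I. x i * e k i)\<^sup>2)" for x
  proof -
    have "quad I (\<lambda>i j. \<Sum>k\<in>K. l k * e k i * e k j) x
        = frob I (\<lambda>i j. x i * x j) (\<lambda>i j. \<Sum>k\<in>K. l k * (e k i * e k j))"
      by (simp only: frob_rank1 mult.assoc)
    also have "\<dots> = (\<Sum>k\<in>K. l k * quad I (\<lambda>i j. x i * x j) (e k))"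
      by (subst frob_commute) (simp only: frob_sum_left frob_scale_left frob_rank1)
    finally show ?thesis by (simp only: quad_rank1)
  qed
  show ?thesis
    unfolding psd_on_def
  proof (intro conjI ballI allI)
    fix i j
    show "(\<Sum>k\<in>K. l k * e k i * e k j) = (\<Sum>k\<in>K. l k * e k j * e k i)"
      by (intro sum.cong refl) (simp only: mult.assoc mult.commute[of "e _ i"])
  next
    show "0 \<le> quad I (\<lambda>i j. \<Sum>k\<in>K. l k * e k i * e k j) x" for x
      unfolding quad using assms(2) by (intro sum_nonneg mult_nonneg_nonneg) auto
  qed
qed

text \<open>The eigenvalues are values of the form at unit vectors, hence nonnegative, and their
  square roots can be absorbed into the eigenvectors.\<close>

lemma psd_on_factorisation:
  assumes "finite I" "psd_on I A"
  shows "\<exists>(r::nat) \<alpha>. \<forall>i\<in>I. \<forall>j\<in>I. A i j = (\<Sum>k<r. \<alpha> k i * \<alpha> k j)"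
proof -
  obtain r :: nat and e l where e: "orthonormal_on I {..<r} e"
    "\<forall>k<r. \<forall>i\<in>I. mat_apply I A (e k) i = l k * e k i"
    "\<forall>i\<in>I. \<forall>j\<in>I. A i j = (\<Sum>k<r. l k * e k i * e k j)"
    using spectral_decomposition[OF assms(1), of A] psd_on_sym[OF assms(2)] by blast
  have "0 \<le> l k" if "k < r" for k
  proof -
    have "quad I A (e k) = inner_on I (e k) (\<lambda>i. l k * e k i)"
      unfolding quad_eq_inner_on by (rule inner_on_cong) (use e(2) that in auto)
    also have "\<dots> = l k * inner_on I (e k) (e k)"
      by (subst inner_on_commute) (rule inner_on_scale_left)
    also have "\<dots> = l k" using e(1) that by (auto simp: orthonormal_on_def)
    finally show ?thesis using psd_on_nonneg[OF assms(2)] by metis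
  qed
  then have "A i j = (\<Sum>k<r. (sqrt (l k) * e k i) * (sqrt (l k) * e k j))" if "i \<in> I" "j \<in> I" for i j
    unfolding e(3)[rule_format, OF that] by (intro sum.cong) (auto simp: algebra_simps simp flip: power2_eq_square)
  then show ?thesis by (intro exI[of _ r] exI[of _ "\<lambda>k i. sqrt (l k) * e k i"]) blast
qed

lemma frob_psd_nonneg:
  assumes "finite I" "psd_on I A" "psd_on I B"
  shows "0 \<le> frob I A B"
proof -
  obtain r :: nat and \<alpha> where \<alpha>: "\<forall>i\<in>I. \<forall>j\<in>I. A i j = (\<Sum>k<r. \<alpha> k i * \<alpha> k j)"
    using psd_on_factorisation[OF assms(1,2)] by blast
  have "frob I A B = frob I (\<lambda>i j. \<Sum>k<r. \<alpha> k i * \<alpha> k j) B" by (rule frob_cong) (use \<alpha> in auto)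
  also have "\<dots> = (\<Sum>k<r. quad I B (\<alpha> k))" by (simp only: frob_sum_left frob_rank1)
  finally show ?thesis using psd_on_nonneg[OF assms(3)] by (simp add: sum_nonneg)
qed

text \<open>Bessel's inequality for each row of \<open>A\<close>: composing with an orthogonal
  projection does not increase the Frobenius norm.\<close>

lemma sum_norm_mat_apply_le:
  assumes "finite K" "orthonormal_on I K e"
  shows "(\<Sum>k\<in>K. inner_on I (mat_apply I A (e k)) (mat_apply I A (e k))) \<le> frob I A A"
proof -
  have "(\<Sum>k\<in>K. inner_on I (mat_apply I A (e k)) (mat_apply I A (e k)))
      = (\<Sum>i\<in>I. \<Sum>k\<in>K. (inner_on I (A i) (e k))\<^sup>2)"
    unfolding inner_on_def[of I "mat_apply I A _"] mat_apply_def power2_eq_square by (rule sum.swap)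
  also have "\<dots> \<le> (\<Sum>i\<in>I. inner_on I (A i) (A i))"
    by (intro sum_mono bessel assms)
  finally show ?thesis by (simp add: frob_eq_sum_inner_on)
qed

lemma sum_inner_mat_apply_le:
  assumes "finite K" "orthonormal_on I K e"
  shows "\<bar>\<Sum>k\<in>K. inner_on I (mat_apply I A (e k)) (mat_apply I B (e k))\<bar> \<le> sqrt (frob I A A) * sqrt (frob I B B)"
proof -
  have "\<bar>\<Sum>k\<in>K. inner_on I (mat_apply I A (e k)) (mat_apply I B (e k))\<bar>
      = \<bar>\<Sum>(k, i)\<in>K \<times> I. mat_apply I A (e k) i * mat_apply I B (e k) i\<bar>"
    by (simp add: inner_on_def sum.cartesian_product)
  also have "\<dots> \<le> sqrt (\<Sum>(k, i)\<in>K \<times> I. (mat_apply I A (e k) i)\<^sup>2) * sqrt (\<Sum>(k, i)\<in>K \<times> I. (mat_apply I B (e k) i)\<^sup>2)"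
    using sum_prod_le_sqrt[of "\<lambda>(k, i). mat_apply I A (e k) i" "\<lambda>(k, i). mat_apply I B (e k) i" "K \<times> I"]
    by (simp add: case_prod_unfold)
  also have "\<dots> = sqrt (\<Sum>k\<in>K. inner_on I (mat_apply I A (e k)) (mat_apply I A (e k)))
      * sqrt (\<Sum>k\<in>K. inner_on I (mat_apply I B (e k)) (mat_apply I B (e k)))"
    by (simp add: inner_on_def sum.cartesian_product power2_eq_square)
  also have "\<dots> \<le> sqrt (frob I A A) * sqrt (frob I B B)"
    by (intro mult_mono real_sqrt_le_mono sum_norm_mat_apply_le assms)
       (auto intro!: sum_nonneg inner_on_self_nonneg frob_self_nonneg)
  finally show ?thesis .
qed

text \<open>For an orthogonal projection \<open>q\<close> this bounds \<open>Tr (A q B)\<close> by the square root of \<open>Tr (A B)\<close>,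
  independently of the dimension.\<close>

lemma sum_inner_mat_apply_psd_le:
  assumes "finite I" "psd_on I A" "psd_on I B" "finite K" "orthonormal_on I K e"
  shows "\<bar>\<Sum>k\<in>K. inner_on I (mat_apply I A (e k)) (mat_apply I B (e k))\<bar>
    \<le> sqrt (frob I A B) * sqrt (sqrt (frob I A A) * sqrt (frob I B B))"
proof -
  obtain r :: nat and \<alpha> where \<alpha>: "\<forall>i\<in>I. \<forall>j\<in>I. A i j = (\<Sum>k<r. \<alpha> k i * \<alpha> k j)"
    using psd_on_factorisation[OF assms(1,2)] by blast
  obtain s :: nat and \<beta> where \<beta>: "\<forall>i\<in>I. \<forall>j\<in>I. B i j = (\<Sum>k<s. \<beta> k i * \<beta> k j)"
    using psd_on_factorisation[OF assms(1,3)] by blast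
  have A_apply: "mat_apply I A x i = (\<Sum>a<r. inner_on I (\<alpha> a) x * \<alpha> a i)" if "i \<in> I" for x i
  proof -
    have "mat_apply I A x i = inner_on I (\<lambda>j. \<Sum>a<r. \<alpha> a i * \<alpha> a j) x"
      unfolding mat_apply_def by (rule inner_on_cong) (use \<alpha> that in auto)
    then show ?thesis by (simp only: inner_on_sum_left inner_on_scale_left mult.commute[of _ "_ i"])
  qed
  have B_apply: "mat_apply I B x i = (\<Sum>b<s. inner_on I (\<beta> b) x * \<beta> b i)" if "i \<in> I" for x i
  proof -
    have "mat_apply I B x i = inner_on I (\<lambda>j. \<Sum>a<s. \<beta> a i * \<beta> a j) x"
      unfolding mat_apply_def by (rule inner_on_cong) (use \<beta> that in auto)
    then show ?thesis by (simp only: inner_on_sum_left inner_on_scale_left mult.commute[of _ "_ i"])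
  qed
  have inner_A: "inner_on I (mat_apply I A x) y = (\<Sum>a<r. inner_on I (\<alpha> a) x * inner_on I (\<alpha> a) y)" for x y
  proof -
    have "inner_on I (mat_apply I A x) y = inner_on I (\<lambda>i. \<Sum>a<r. inner_on I (\<alpha> a) x * \<alpha> a i) y"
      by (rule inner_on_cong) (use A_apply in auto)
    then show ?thesis by (simp add: inner_on_sum_left inner_on_scale_left)
  qed
  have inner_B: "inner_on I (mat_apply I B x) y = (\<Sum>b<s. inner_on I (\<beta> b) x * inner_on I (\<beta> b) y)" for x y
  proof -
    have "inner_on I (mat_apply I B x) y = inner_on I (\<lambda>i. \<Sum>a<s. inner_on I (\<beta> a) x * \<beta> a i) y"
      by (rule inner_on_cong) (use B_apply in auto)
    then show ?thesis by (simp add: inner_on_sum_left inner_on_scale_left)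
  qed
  let ?R = "{..<r} \<times> {..<s}"
  \<comment> \<open>With \<open>Q\<close> the projection onto the span of the \<open>e k\<close>,
    \<open>g\<close> holds the inner products of \<open>\<alpha> a\<close> and
    \<open>\<beta> b\<close>, and \<open>q\<close> those of \<open>Q\<close> applied to both. The
    left side is the sum of \<open>g p * q p\<close>, to which Cauchy-Schwarz applies; the squares
    of \<open>g\<close> add up to \<open>frob I A B\<close>.\<close>
  define g where "g = (\<lambda>(a, b). inner_on I (\<alpha> a) (\<beta> b))"
  define q where "q = (\<lambda>(a, b). \<Sum>k\<in>K. inner_on I (\<alpha> a) (e k) * inner_on I (\<beta> b) (e k))"
  have AB: "inner_on I (mat_apply I A x) (mat_apply I B x)
      = (\<Sum>p\<in>?R. g p * (inner_on I (\<alpha> (fst p)) x * inner_on I (\<beta> (snd p)) x))" for x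
  proof -
    have "inner_on I (mat_apply I A x) (mat_apply I B x)
        = (\<Sum>a<r. inner_on I (\<alpha> a) x * inner_on I (mat_apply I B x) (\<alpha> a))"
      unfolding inner_A by (simp add: inner_on_commute[of I _ "mat_apply I B x"])
    also have "\<dots> = (\<Sum>a<r. \<Sum>b<s. g (a, b) * (inner_on I (\<alpha> a) x * inner_on I (\<beta> b) x))"
      unfolding inner_B g_def sum_distrib_left
      by (intro sum.cong refl) (simp add: inner_on_commute[of I "\<beta> _" "\<alpha> _"])
    finally show ?thesis by (simp add: sum.cartesian_product case_prod_unfold)
  qed
  have "(\<Sum>k\<in>K. inner_on I (mat_apply I A (e k)) (mat_apply I B (e k))) = (\<Sum>p\<in>?R. g p * q p)"
    unfolding AB by (subst sum.swap) (simp add: q_def case_prod_unfold sum_distrib_left)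
  then have main: "\<bar>\<Sum>k\<in>K. inner_on I (mat_apply I A (e k)) (mat_apply I B (e k))\<bar>
      \<le> sqrt (\<Sum>p\<in>?R. (g p)\<^sup>2) * sqrt (\<Sum>p\<in>?R. (q p)\<^sup>2)"
    using sum_prod_le_sqrt[of g q ?R] by simp
  have g2: "(\<Sum>p\<in>?R. (g p)\<^sup>2) = frob I A B"
  proof -
    have "frob I A B = frob I (\<lambda>i j. \<Sum>a<r. \<alpha> a i * \<alpha> a j) B" by (rule frob_cong) (use \<alpha> in auto)
    also have "\<dots> = (\<Sum>a<r. quad I B (\<alpha> a))" by (simp only: frob_sum_left frob_rank1)
    also have "\<dots> = (\<Sum>a<r. \<Sum>b<s. (g (a, b))\<^sup>2)"
      by (intro sum.cong refl)
        (simp add: quad_eq_inner_on inner_on_commute[of I _ "mat_apply I B _"] inner_B g_def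
          power2_eq_square inner_on_commute[of I "\<beta> _" "\<alpha> _"])
    finally show ?thesis by (simp add: sum.cartesian_product)
  qed
  \<comment> \<open>The compression of \<open>M\<close> to the span of the \<open>e k\<close> has at
    most the Frobenius norm of \<open>M\<close>.\<close>
  have elem: "(\<Sum>k\<in>K. \<Sum>l\<in>K. (inner_on I (mat_apply I M (e k)) (e l))\<^sup>2) \<le> frob I M M" for M
    using sum_mono[of K "\<lambda>k. \<Sum>l\<in>K. (inner_on I (mat_apply I M (e k)) (e l))\<^sup>2"
        "\<lambda>k. inner_on I (mat_apply I M (e k)) (mat_apply I M (e k))"]
      bessel[OF assms(4,5)] sum_norm_mat_apply_le[OF assms(4,5), of M] by fastforce
  \<comment> \<open>The squares of \<open>q\<close> add up to the Frobenius product of the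
    compressions of \<open>A\<close> and \<open>B\<close>.\<close>
  have "(\<Sum>p\<in>?R. (q p)\<^sup>2) = (\<Sum>(k, l)\<in>K \<times> K.
      inner_on I (mat_apply I A (e k)) (e l) * inner_on I (mat_apply I B (e k)) (e l))"
  proof -
    have "(\<Sum>p\<in>?R. (q p)\<^sup>2) = (\<Sum>p\<in>?R. \<Sum>(k, l)\<in>K \<times> K.
        (inner_on I (\<alpha> (fst p)) (e k) * inner_on I (\<beta> (snd p)) (e k))
        * (inner_on I (\<alpha> (fst p)) (e l) * inner_on I (\<beta> (snd p)) (e l)))"
      by (intro sum.cong refl) (simp add: q_def case_prod_unfold power2_eq_square sum_product sum.cartesian_product)
    also have "\<dots> = (\<Sum>kl\<in>K \<times> K. \<Sum>p\<in>?R.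
        (inner_on I (\<alpha> (fst p)) (e (fst kl)) * inner_on I (\<alpha> (fst p)) (e (snd kl)))
        * (inner_on I (\<beta> (snd p)) (e (fst kl)) * inner_on I (\<beta> (snd p)) (e (snd kl))))"
      by (subst sum.swap) (intro sum.cong refl, simp add: case_prod_unfold mult.assoc mult.left_commute)
    also have "\<dots> = (\<Sum>(k, l)\<in>K \<times> K.
        inner_on I (mat_apply I A (e k)) (e l) * inner_on I (mat_apply I B (e k)) (e l))"
      unfolding inner_A inner_B by (simp add: sum_product sum.cartesian_product case_prod_unfold)
    finally show ?thesis .
  qed
  also have "\<dots> \<le> sqrt (\<Sum>(k, l)\<in>K \<times> K. (inner_on I (mat_apply I A (e k)) (e l))\<^sup>2)
      * sqrt (\<Sum>(k, l)\<in>K \<times> K. (inner_on I (mat_apply I B (e k)) (e l))\<^sup>2)"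
    using sum_prod_le_sqrt[of "\<lambda>(k, l). inner_on I (mat_apply I A (e k)) (e l)"
        "\<lambda>(k, l). inner_on I (mat_apply I B (e k)) (e l)" "K \<times> K"]
    by (simp add: case_prod_unfold)
  also have "\<dots> \<le> sqrt (frob I A A) * sqrt (frob I B B)"
    by (intro mult_mono real_sqrt_le_mono)
      (use elem in \<open>auto simp: sum.cartesian_product[symmetric] frob_self_nonneg intro!: sum_nonneg\<close>)
  finally show ?thesis
    using main g2 by (smt (verit) mult_left_mono real_sqrt_ge_zero real_sqrt_le_mono frob_psd_nonneg[OF assms(1-3)])
qed

text \<open>The sum over \<open>K\<close> is the positive part of \<open>B - C\<close>.\<close>

lemma almost_orthogonal_positive_part:
  assumes "finite I" "psd_on I B" "psd_on I C"
  shows "\<exists>(K::nat set) e l. finite K \<and> orthonormal_on I K e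
    \<and> (\<forall>k\<in>K. \<forall>i\<in>I. l k * e k i = mat_apply I (\<lambda>i j. B i j - C i j) (e k) i)
    \<and> frob I (\<lambda>i j. B i j - (\<Sum>k\<in>K. l k * e k i * e k j)) (\<lambda>i j. B i j - (\<Sum>k\<in>K. l k * e k i * e k j))
      \<le> frob I B C"
proof -
  let ?D = "\<lambda>i j. B i j - C i j"
  have sym: "?D i j = ?D j i" if "i \<in> I" "j \<in> I" for i j
    using psd_on_sym[OF assms(2) that] psd_on_sym[OF assms(3) that] by simp
  obtain r :: nat and e l where e: "orthonormal_on I {..<r} e"
    "\<forall>k<r. \<forall>i\<in>I. mat_apply I ?D (e k) i = l k * e k i"
    "\<forall>i\<in>I. \<forall>j\<in>I. ?D i j = (\<Sum>k<r. l k * e k i * e k j)"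
    using spectral_decomposition[OF assms(1), of ?D] sym by blast
  define K where "K = {k. k < r \<and> 0 < l k}"
  define L where "L = {k. k < r \<and> \<not> 0 < l k}"
  have KL: "{..<r} = K \<union> L" "K \<inter> L = {}" "finite K" "finite L" by (auto simp: K_def L_def)
  define P where "P i j = (\<Sum>k\<in>K. l k * e k i * e k j)" for i j
  define N where "N i j = (\<Sum>k\<in>L. (- l k) * e k i * e k j)" for i j
  \<comment> \<open>Since \<open>B - C = P - N\<close>, the remainder \<open>R\<close> equals both
    \<open>B - P\<close> and \<open>C - N\<close>.\<close>
  define R where "R i j = B i j - P i j" for i j
  have psdP: "psd_on I P" unfolding P_def by (intro psd_on_rank1_sum KL) (auto simp: K_def)
  have psdN: "psd_on I N" unfolding N_def by (intro psd_on_rank1_sum KL) (auto simp: L_def)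
  have D: "?D i j = P i j - N i j" if "i \<in> I" "j \<in> I" for i j
    unfolding e(3)[rule_format, OF that] P_def N_def KL(1) by (subst sum.union_disjoint) (use KL in \<open>auto simp: sum_negf\<close>)
  have PN: "frob I P N = 0"
  proof -
    have "frob I P N = (\<Sum>k\<in>K. l k * quad I N (e k))"
      unfolding P_def by (simp only: mult.assoc frob_sum_left frob_scale_left frob_rank1)
    moreover have "quad I N (e k) = 0" if "k \<in> K" for k
    proof -
      have "quad I N (e k) = frob I N (\<lambda>i j. e k i * e k j)" by (subst frob_commute) (simp only: frob_rank1)
      also have "\<dots> = (\<Sum>m\<in>L. (- l m) * (inner_on I (e k) (e m))\<^sup>2)"
        unfolding N_def by (simp only: mult.assoc frob_sum_left frob_scale_left frob_rank1 quad_rank1 inner_on_def)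
      also have "\<dots> = 0"
        using e(1) that KL(2) by (intro sum.neutral) (auto simp: orthonormal_on_def K_def L_def)
      finally show ?thesis .
    qed
    ultimately show ?thesis by simp
  qed
  have B: "frob I B Y = frob I P Y + frob I R Y" for Y
  proof -
    have "frob I B Y = frob I (\<lambda>i j. P i j + R i j) Y" by (rule frob_cong) (auto simp: R_def)
    then show ?thesis by (simp add: frob_add_left)
  qed
  have C: "frob I C Y = frob I N Y + frob I R Y" for Y
  proof -
    have "frob I C Y = frob I (\<lambda>i j. N i j + R i j) Y"
    proof (rule frob_cong)
      fix i j assume "i \<in> I" "j \<in> I"
      then show "C i j = N i j + R i j" using D[of i j] by (simp add: R_def)
    qed simp
    then show ?thesis by (simp add: frob_add_left)
  qed
  \<comment> \<open>As \<open>P\<close> and \<open>N\<close> are orthogonal, these two products are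
    \<open>frob I R P\<close> and \<open>frob I R N\<close>. Expanding \<open>frob I B C\<close>
    with \<open>B = P + R\<close> and \<open>C = N + R\<close> then leaves \<open>frob I R R\<close>
    plus nonnegative terms.\<close>
  have "0 \<le> frob I C P" "0 \<le> frob I B N"
    using frob_psd_nonneg[OF assms(1)] assms psdP psdN by blast+
  then have "0 \<le> frob I R P" "0 \<le> frob I R N" using C[of P] B[of N] PN frob_commute[of I P N] by auto
  moreover have "frob I B C = frob I C P + frob I C R"
    using B[of C] by (simp add: frob_commute)
  then have "frob I B C = frob I N P + frob I R P + frob I N R + frob I R R" unfolding C by simp
  ultimately have "frob I R R \<le> frob I B C" using PN by (simp add: frob_commute)
  moreover have "orthonormal_on I K e" using e(1) by (auto simp: orthonormal_on_def K_def)
  ultimately show ?thesis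
    using KL(3) e(2) unfolding R_def P_def
    by (intro exI[of _ K] exI[of _ e] exI[of _ l]) (auto simp: K_def)
qed

text \<open>Since \<open>P b\<close> and \<open>P c\<close> are almost orthogonal,
  \<open>P b\<close> is close to the positive part of \<open>P b - P c\<close>, that is, to this
  difference times a spectral projection. The difference is the small combination of all
  \<open>P m\<close> minus terms almost orthogonal to \<open>P a\<close>, and inserting the
  projection costs only square roots. The bound is independent of \<open>I\<close>.\<close>

lemma almost_kernel_vector_bound:
  assumes "finite I" "finite J" "\<And>j. j \<in> J \<Longrightarrow> psd_on I (P j)"
    "a \<in> J" "b \<in> J" "c \<in> J" "distinct [a, b, c]"
    "w a = 0" "w b = 1" "w c = -1" "\<And>j. j \<in> J \<Longrightarrow> \<bar>w j\<bar> \<le> 1"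
    "\<And>j. j \<in> J \<Longrightarrow> frob I (P j) (P j) \<le> N"
    "\<And>j. j \<in> J - {a, b, c} \<Longrightarrow> w j \<noteq> 0 \<Longrightarrow> frob I (P a) (P j) \<le> \<epsilon>" "frob I (P b) (P c) \<le> \<epsilon>"
    "frob I (\<lambda>i j. \<Sum>m\<in>J. w m * P m i j) (\<lambda>i j. \<Sum>m\<in>J. w m * P m i j) \<le> \<delta>" "0 \<le> \<epsilon>"
  shows "frob I (P a) (P b) \<le> sqrt N * sqrt \<epsilon> + sqrt N * sqrt \<delta> + card J * (sqrt \<epsilon> * sqrt N)"
proof -
  let ?A = "P a" and ?B = "P b" and ?C = "P c"
  let ?W = "\<lambda>i j. \<Sum>m\<in>J. w m * P m i j"
  let ?J = "J - {a, b, c}"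
  obtain K :: "nat set" and e l where K: "finite K" "orthonormal_on I K e"
    and eig: "\<forall>k\<in>K. \<forall>i\<in>I. l k * e k i = mat_apply I (\<lambda>i j. ?B i j - ?C i j) (e k) i"
    and close: "frob I (\<lambda>i j. ?B i j - (\<Sum>k\<in>K. l k * e k i * e k j)) (\<lambda>i j. ?B i j - (\<Sum>k\<in>K. l k * e k i * e k j))
      \<le> frob I ?B ?C"
    using almost_orthogonal_positive_part[OF assms(1) assms(3)[OF assms(5)] assms(3)[OF assms(6)]] by blast
  let ?D = "\<lambda>i j. \<Sum>k\<in>K. l k * e k i * e k j"
  let ?R = "\<lambda>i j. ?B i j - ?D i j"
  have N: "0 \<le> N" using assms(12)[OF assms(4)] frob_self_nonneg[of I ?A] by linarith
  have W_split: "?W i j = ?B i j - ?C i j + (\<Sum>m\<in>?J. w m * P m i j)" for i j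
  proof -
    have "?W i j = (\<Sum>m\<in>?J. w m * P m i j) + (\<Sum>m\<in>{a, b, c}. w m * P m i j)"
      using assms(2,4-6) by (intro sum.subset_diff) auto
    then show ?thesis using assms(7-10) by simp
  qed
  have apply_D: "mat_apply I (\<lambda>i j. ?B i j - ?C i j) x i
      = mat_apply I ?W x i - (\<Sum>m\<in>?J. w m * mat_apply I (P m) x i)" for x i
    unfolding W_split mat_apply_def by (simp add: inner_on_add_left inner_on_sum_left inner_on_scale_left)
  \<comment> \<open>\<open>?G M\<close> is the trace of \<open>P a\<close>, the spectral projection
    and \<open>M\<close> multiplied together.\<close>
  let ?G = "\<lambda>M. \<Sum>k\<in>K. inner_on I (mat_apply I ?A (e k)) (mat_apply I M (e k))"
  have "frob I ?A ?B = frob I ?R ?A + frob I ?D ?A"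
  proof -
    have "frob I ?B ?A = frob I (\<lambda>i j. ?R i j + ?D i j) ?A" by (rule frob_cong) auto
    then show ?thesis by (simp only: frob_add_left frob_commute[of I ?A ?B])
  qed
  moreover have "frob I ?R ?A \<le> sqrt N * sqrt \<epsilon>"
  proof -
    have "\<bar>frob I ?R ?A\<bar> \<le> sqrt (frob I ?R ?R) * sqrt (frob I ?A ?A)" by (rule frob_cauchy_schwarz)
    also have "\<dots> \<le> sqrt \<epsilon> * sqrt N"
      using close assms(14) assms(12)[OF assms(4)]
      by (intro mult_mono real_sqrt_le_mono) (auto simp: frob_self_nonneg assms(16))
    finally show ?thesis by (simp add: mult.commute)
  qed
  \<comment> \<open>The eigenvalue equation replaces \<open>l k * e k\<close> by
    \<open>P b - P c\<close> applied to \<open>e k\<close>, which \<open>apply_D\<close> rewrites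
    through \<open>?W\<close> and the remaining matrices.\<close>
  moreover have "frob I ?D ?A = ?G ?W - (\<Sum>m\<in>?J. w m * ?G (P m))"
  proof -
    have "frob I ?D ?A = (\<Sum>k\<in>K. l k * quad I ?A (e k))"
      by (simp only: mult.assoc frob_sum_left frob_scale_left frob_rank1)
    also have "\<dots> = (\<Sum>k\<in>K. inner_on I (\<lambda>i. l k * e k i) (mat_apply I ?A (e k)))"
      by (simp add: inner_on_scale_left quad_eq_inner_on)
    also have "\<dots> = (\<Sum>k\<in>K. inner_on I (\<lambda>i. mat_apply I ?W (e k) i - (\<Sum>m\<in>?J. w m * mat_apply I (P m) (e k) i))
        (mat_apply I ?A (e k)))"
      by (intro sum.cong refl inner_on_cong) (auto simp: eig apply_D)
    also have "\<dots> = ?G ?W - (\<Sum>k\<in>K. \<Sum>m\<in>?J. w m * inner_on I (mat_apply I ?A (e k)) (mat_apply I (P m) (e k)))"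
      by (simp add: inner_on_diff_left inner_on_sum_left inner_on_scale_left sum_subtractf
          inner_on_commute[of I _ "mat_apply I ?A _"])
    also have "(\<Sum>k\<in>K. \<Sum>m\<in>?J. w m * inner_on I (mat_apply I ?A (e k)) (mat_apply I (P m) (e k)))
        = (\<Sum>m\<in>?J. w m * ?G (P m))"
      unfolding sum_distrib_left by (rule sum.swap)
    finally show ?thesis .
  qed
  moreover have "?G ?W \<le> sqrt N * sqrt \<delta>"
  proof -
    have "?G ?W \<le> sqrt (frob I ?A ?A) * sqrt (frob I ?W ?W)"
      using sum_inner_mat_apply_le[OF K, of ?A ?W] by linarith
    also have "\<dots> \<le> sqrt N * sqrt \<delta>"
      using assms(12)[OF assms(4)] assms(15) N
      by (intro mult_mono real_sqrt_le_mono) (auto simp: frob_self_nonneg)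
    finally show ?thesis .
  qed
  moreover have "- (\<Sum>m\<in>?J. w m * ?G (P m)) \<le> card J * (sqrt \<epsilon> * sqrt N)"
  proof -
    have "- (w m * ?G (P m)) \<le> sqrt \<epsilon> * sqrt N" if m: "m \<in> ?J" for m
    proof (cases "w m = 0")
      case True
      then show ?thesis using N assms(16) by simp
    next
      case False
      have "\<bar>?G (P m)\<bar> \<le> sqrt (frob I ?A (P m)) * sqrt (sqrt (frob I ?A ?A) * sqrt (frob I (P m) (P m)))"
        by (rule sum_inner_mat_apply_psd_le) (use assms m K in auto)
      also have "\<dots> \<le> sqrt \<epsilon> * sqrt (sqrt N * sqrt N)"
        using assms(12)[OF assms(4)] assms(12)[of m] assms(13)[OF m False] m N
          frob_psd_nonneg[OF assms(1) assms(3)[OF assms(4)] assms(3)[of m]] assms(16)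
        by (intro mult_mono real_sqrt_le_mono) (auto simp: frob_self_nonneg)
      finally have "\<bar>?G (P m)\<bar> \<le> sqrt \<epsilon> * sqrt N" using N by simp
      moreover have "\<bar>w m * ?G (P m)\<bar> \<le> 1 * \<bar>?G (P m)\<bar>"
        unfolding abs_mult by (rule mult_right_mono) (use assms(11)[of m] m in auto)
      ultimately show ?thesis by linarith
    qed
    then have "(\<Sum>m\<in>?J. - (w m * ?G (P m))) \<le> (\<Sum>m\<in>?J. sqrt \<epsilon> * sqrt N)" by (rule sum_mono)
    also have "\<dots> = card ?J * (sqrt \<epsilon> * sqrt N)" by simp
    also have "\<dots> \<le> card J * (sqrt \<epsilon> * sqrt N)"
      by (intro mult_right_mono) (use assms(2,16) N in \<open>auto intro!: card_mono\<close>)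
    finally show ?thesis by (simp add: sum_negf)
  qed
  ultimately show ?thesis by linarith
qed

section \<open>From Hermitian to real symmetric matrices\<close>

definition real_embedding :: "(nat \<Rightarrow> nat \<Rightarrow> complex) \<Rightarrow> nat \<times> bool \<Rightarrow> nat \<times> bool \<Rightarrow> real" where
  "real_embedding P = (\<lambda>(i, s) (j, t). if s = t then Re (P i j) else if s then Im (P i j) else - Im (P i j))"

lemma sum_prod_bool: "(\<Sum>p\<in>A \<times> (UNIV :: bool set). g p) = (\<Sum>i\<in>A. g (i, False) + g (i, True))"
  for g :: "'i \<times> bool \<Rightarrow> real"
proof -
  have "(\<Sum>p\<in>A \<times> (UNIV :: bool set). g p) = (\<Sum>i\<in>A. \<Sum>s\<in>UNIV. g (i, s))"
    by (simp add: sum.cartesian_product)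
  also have "\<dots> = (\<Sum>i\<in>A. g (i, False) + g (i, True))"
    by (intro sum.cong refl) (simp add: UNIV_bool)
  finally show ?thesis .
qed

lemma hermitian_entries:
  assumes "hermitian d P" "i < d" "j < d"
  shows "Re (P j i) = Re (P i j)" "Im (P j i) = - Im (P i j)"
proof -
  have "P j i = cnj (P i j)" using assms unfolding hermitian_def by blast
  then show "Re (P j i) = Re (P i j)" "Im (P j i) = - Im (P i j)" by simp_all
qed

text \<open>Index \<open>(i, False)\<close> carries the real and \<open>(i, True)\<close> the
  imaginary part of coordinate \<open>i\<close>. The embedded matrix is the real matrix of
  multiplication by \<open>P\<close>, so its form at \<open>x\<close> is the real part of the
  complex form at \<open>?v\<close>.\<close>

lemma psd_on_real_embedding:
  assumes "hermitian_psd d P"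
  shows "psd_on ({..<d} \<times> UNIV) (real_embedding P)"
  unfolding psd_on_def
proof (intro conjI ballI allI)
  fix p q assume "p \<in> {..<d} \<times> (UNIV :: bool set)" "q \<in> {..<d} \<times> (UNIV :: bool set)"
  then show "real_embedding P p q = real_embedding P q p"
    using assms hermitian_entries[of d P "fst p" "fst q"]
    by (auto simp: real_embedding_def hermitian_psd_def split: prod.splits)
next
  fix x :: "nat \<times> bool \<Rightarrow> real"
  let ?v = "\<lambda>i. Complex (x (i, False)) (x (i, True))"
  have "quad ({..<d} \<times> UNIV) (real_embedding P) x = Re (\<Sum>i<d. \<Sum>j<d. cnj (?v i) * P i j * ?v j)"
    unfolding quad_def sum_prod_bool Re_sum sum.distrib[symmetric]
    by (intro sum.cong refl) (simp add: real_embedding_def algebra_simps)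
  moreover have "0 \<le> Re (\<Sum>i<d. \<Sum>j<d. cnj (?v i) * P i j * ?v j)"
    using spec[OF conjunct2[OF assms[unfolded hermitian_psd_def]], of ?v] .
  ultimately show "0 \<le> quad ({..<d} \<times> UNIV) (real_embedding P) x" by linarith
qed

text \<open>By Hermitian symmetry \<open>Q j i\<close> is the conjugate of \<open>Q i j\<close>.
  Real and imaginary parts each occur twice in the embedding, whence the factor 2.\<close>

lemma frob_real_embedding:
  assumes "hermitian d Q"
  shows "frob ({..<d} \<times> UNIV) (real_embedding P) (real_embedding Q) = 2 * Re (trace_prod d P Q)"
  unfolding frob_def trace_prod_def sum_prod_bool Re_sum sum.distrib[symmetric] sum_distrib_left
proof (intro sum.cong refl)
  fix i j assume "i \<in> {..<d}" "j \<in> {..<d}"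
  then have "Re (Q j i) = Re (Q i j)" "Im (Q j i) = - Im (Q i j)"
    using hermitian_entries[OF assms, of i j] by auto
  then show "real_embedding P (i, False) (j, False) * real_embedding Q (i, False) (j, False)
      + real_embedding P (i, False) (j, True) * real_embedding Q (i, False) (j, True)
      + (real_embedding P (i, True) (j, False) * real_embedding Q (i, True) (j, False)
      + real_embedding P (i, True) (j, True) * real_embedding Q (i, True) (j, True))
    = 2 * Re (P i j * Q j i)"
    by (simp add: real_embedding_def)
qed

section \<open>A doubly nonnegative matrix on an odd cycle\<close>

lemma cycle_graph_iff:
  assumes "3 \<le> k"
  shows "(u, v) \<in> cycle_graph k \<longleftrightarrow> u \<in> {1..k} \<and> v \<in> {1..k}
    \<and> (u = v + 1 \<or> v = u + 1 \<or> (u = 1 \<and> v = k) \<or> (u = k \<and> v = 1))"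
proof -
  have "int k dvd int u - int v - 1 \<longleftrightarrow> u = v + 1 \<or> (u = 1 \<and> v = k)"
    if uv: "u \<in> {1..k}" "v \<in> {1..k}" for u v
  proof
    assume "int k dvd int u - int v - 1"
    then obtain q where q: "int u - int v - 1 = int k * q" by (auto elim: dvdE)
    \<comment> \<open>The difference \<open>u - v - 1\<close> lies between \<open>- k\<close> and
      \<open>k - 2\<close>, which leaves only the multiples 0 and \<open>- k\<close>.\<close>
    have "q < 1"
    proof (rule ccontr)
      assume "\<not> q < 1"
      then have "int k * 1 \<le> int k * q" by (intro mult_left_mono) auto
      then show False using q uv by auto
    qed
    moreover have "q > -2"
    proof (rule ccontr)
      assume "\<not> q > -2"
      then have "int k * q \<le> int k * -2" by (intro mult_left_mono) auto
      then show False using q uv assms by auto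
    qed
    ultimately have "q = 0 \<or> q = -1" by auto
    then show "u = v + 1 \<or> (u = 1 \<and> v = k)" using q uv by auto
  next
    assume "u = v + 1 \<or> (u = 1 \<and> v = k)"
    then show "int k dvd int u - int v - 1" by auto
  qed
  note * = this
  have "(int u - int v) mod int k = 1 mod int k \<longleftrightarrow> int k dvd int u - int v - 1"
    by (rule mod_eq_dvd_iff)
  moreover have "(int u - int v) mod int k = (- 1) mod int k \<longleftrightarrow> int k dvd int v - int u - 1"
    unfolding mod_eq_dvd_iff by (subst dvd_minus_iff[symmetric]) (simp add: algebra_simps)
  ultimately show ?thesis
    unfolding cycle_graph_def using *[of u v] *[of v u] by auto
qed

lemma long_odd_cycle_imp_subgraph:
  assumes "is_graph n G" "long_odd_cycle G"
  shows "\<exists>t\<ge>2. has_subgraph_iso n G (2 * t + 1) (cycle_graph (2 * t + 1))"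
proof -
  obtain xs where xs: "closed_walk G xs" "distinct xs" "odd (length xs)" "5 \<le> length xs"
    using assms(2) unfolding long_odd_cycle_def by blast
  obtain t where t: "length xs = 2 * t + 1" using xs(3) oddE by blast
  define k where "k = 2 * t + 1"
  have k: "length xs = k" "5 \<le> k" using t xs(4) by (auto simp: k_def)
  have G_sym: "(v, u) \<in> G" if "(u, v) \<in> G" for u v using assms(1) that by (auto simp: is_graph_def)
  \<comment> \<open>Lists are indexed from 0, the vertices of the cycle from 1.\<close>
  define f where "f i = xs ! (i - 1)" for i
  have step: "(f i, f (i + 1)) \<in> G" if "1 \<le> i" "i < k" for i
  proof -
    have "\<forall>j. Suc j < k \<longrightarrow> (xs ! j, xs ! Suc j) \<in> G"
      using xs(1) k(1) unfolding closed_walk_def successively_conv_nth by blast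
    moreover have "Suc (i - 1) < k" using that by simp
    ultimately have "(xs ! (i - 1), xs ! Suc (i - 1)) \<in> G" by blast
    then show ?thesis using that by (simp add: f_def)
  qed
  have wrap: "(f k, f 1) \<in> G"
    using xs(1) k unfolding closed_walk_def f_def by (auto simp: last_conv_nth hd_conv_nth)
  have "inj_on f {1..k}"
    using xs(2) k(1) by (auto simp: inj_on_def f_def nth_eq_iff_index_eq)
  moreover have "f ` {1..k} \<subseteq> {1..n}"
  proof
    fix u assume "u \<in> f ` {1..k}"
    then obtain i where i: "u = f i" "1 \<le> i" "i \<le> k" by auto
    have "\<exists>v. (u, v) \<in> G"
    proof (cases "i = k")
      case True
      then show ?thesis using wrap i(1) by auto
    next
      case False
      then show ?thesis using step[of i] i by auto
    qed
    then show "u \<in> {1..n}" using assms(1) unfolding is_graph_def by blast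
  qed
  moreover have "(f u, f v) \<in> G" if "(u, v) \<in> cycle_graph k" for u v
    using that k(2) step wrap G_sym by (auto simp: cycle_graph_iff)
  ultimately have "has_subgraph_iso n G k (cycle_graph k)"
    unfolding has_subgraph_iso_def by blast
  moreover have "t \<ge> 2" using k unfolding k_def by simp
  ultimately show ?thesis unfolding k_def by blast
qed

text \<open>The Gram matrix of the forms \<open>x\<^sub>i + x\<^bsub>i+1\<^esub> + (-1)\<^sup>i x\<^sub>1\<close> for \<open>2 \<le> i < k\<close>. For odd \<open>k\<close> its support is the
  cycle on \<open>{1..k}\<close>, and the vector with entries \<open>(-1)\<^sup>i\<close> for \<open>i \<ge> 2\<close> and a zero in position 1 lies in its kernel.\<close>

definition cycle_form :: "nat \<Rightarrow> nat \<Rightarrow> real" where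
  "cycle_form i j = of_bool (j = i) + of_bool (j = i + 1) + (-1) ^ i * of_bool (j = 1)"

definition cycle_gram :: "nat \<Rightarrow> nat \<Rightarrow> nat \<Rightarrow> real" where
  "cycle_gram k j m = (\<Sum>i\<in>{2..<k}. cycle_form i j * cycle_form i m)"

lemma cycle_gram_commute: "cycle_gram k j m = cycle_gram k m j"
  by (simp add: cycle_gram_def mult.commute)

text \<open>Form \<open>m\<close> contributes \<open>(-1) ^ m\<close> and form \<open>m - 1\<close>
  the opposite sign, so they cancel when both exist. For \<open>m = 2\<close> only the first exists,
  for \<open>m = k\<close> only the second; oddness of \<open>k\<close> makes the latter
  \<open>+1\<close>.\<close>

lemma cycle_gram_first_row:
  assumes "2 \<le> m" "m \<le> k" "odd k" "5 \<le> k"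
  shows "cycle_gram k 1 m = of_bool (m = 2 \<or> m = k)"
proof -
  have "cycle_gram k 1 m = (\<Sum>i\<in>{2..<k}. (if i = m then (-1) ^ i else 0) + (if i = m - 1 then (-1) ^ i else 0))"
    unfolding cycle_gram_def by (intro sum.cong refl) (use assms(1) in \<open>auto simp: cycle_form_def\<close>)
  also have "\<dots> = (if m < k then (-1) ^ m else 0) + (if 3 \<le> m then (-1) ^ (m - 1) else 0)"
    unfolding sum.distrib using assms by (auto simp: sum.delta)
  also have "\<dots> = of_bool (m = 2 \<or> m = k)"
  proof -
    have "(-1 :: real) ^ (m - 1) = - ((-1) ^ m)" using assms(1) by (cases m) auto
    note shift = this
    consider "m = 2" | "3 \<le> m" "m < k" | "m = k" using assms(1,2) by linarith
    then show ?thesis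
    proof cases
      case 1
      then show ?thesis using assms(4) by simp
    next
      case 2
      then show ?thesis unfolding shift by simp
    next
      case 3
      then show ?thesis unfolding shift using assms(3,4) by simp
    qed
  qed
  finally show ?thesis .
qed

lemma cycle_gram_nonneg:
  assumes "j \<in> {1..k}" "m \<in> {1..k}" "odd k" "5 \<le> k"
  shows "0 \<le> cycle_gram k j m"
proof (cases "j = 1 \<or> m = 1")
  case True
  show ?thesis
  proof (cases "j = m")
    case True
    then show ?thesis by (simp add: cycle_gram_def sum_nonneg)
  next
    case False
    then have "cycle_gram k j m = cycle_gram k 1 (if j = 1 then m else j)"
      using True by (auto simp: cycle_gram_commute)
    then show ?thesis using cycle_gram_first_row[of "if j = 1 then m else j" k] False True assms
      by (auto split: if_splits)
  qed
next
  case False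
  then show ?thesis
    unfolding cycle_gram_def by (intro sum_nonneg) (auto simp: cycle_form_def)
qed

lemma cycle_gram_zero:
  assumes "2 \<le> j" "j + 1 < m"
  shows "cycle_gram k j m = 0"
  unfolding cycle_gram_def by (intro sum.neutral) (use assms in \<open>auto simp: cycle_form_def\<close>)

text \<open>The cycle matrix is carried into \<open>G\<close> as \<open>Y\<close>, and adding
  \<open>\<epsilon> * Z\<close> makes the support exactly \<open>G\<close>. If all these matrices
  were cpsd, \<open>almost_kernel_vector_bound\<close> would push the entry at
  \<open>(f 1, f 2)\<close> to zero with \<open>\<epsilon>\<close>, although in \<open>Y\<close> it
  is 1.\<close>

lemma cpsd_graph_imp_no_long_odd_cycle:
  assumes "is_graph n G" "odd k" "5 \<le> k" "has_subgraph_iso n G k (cycle_graph k)"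
  shows "\<not> cpsd_graph n G"
proof
  assume cpsd_graph: "cpsd_graph n G"
  obtain f where f: "inj_on f {1..k}" "f ` {1..k} \<subseteq> {1..n}"
    "\<And>u v. (u, v) \<in> cycle_graph k \<Longrightarrow> (f u, f v) \<in> G"
    using assms(4) unfolding has_subgraph_iso_def by blast
  have G_sub: "G \<subseteq> {1..n} \<times> {1..n}" and G_sym: "\<And>u v. (u, v) \<in> G \<Longrightarrow> (v, u) \<in> G"
    and G_irr: "\<And>u. (u, u) \<notin> G"
    using assms(1) by (auto simp: is_graph_def)
  have finG: "finite G" by (rule finite_subset[OF G_sub]) simp
  have f_eq: "f i = f j \<longleftrightarrow> i = j" if "i \<in> {1..k}" "j \<in> {1..k}" for i j
    using f(1) that by (auto dest: inj_onD)
  have f_in: "f j \<in> {1..n}" if "j \<in> {1..k}" for j using f(2) that by blast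
  define b :: "nat \<Rightarrow> nat \<Rightarrow> real" where "b i u = of_bool (u = f i) + of_bool (u = f (i + 1)) + (-1) ^ i * of_bool (u = f 1)"
    for i u
  \<comment> \<open>The factor 1 is the weight expected by \<open>psd_on_rank1_sum\<close>.\<close>
  define Y :: "nat \<Rightarrow> nat \<Rightarrow> real" where "Y u v = (\<Sum>i\<in>{2..<k}. 1 * b i u * b i v)" for u v
  define c :: "nat \<times> nat \<Rightarrow> nat \<Rightarrow> real" where "c = (\<lambda>(p, q) u. of_bool (u = p) + of_bool (u = q))"
  \<comment> \<open>The signless Laplacian of \<open>G\<close>: positive semidefinite, with the
    adjacency matrix off the diagonal. \<open>G\<close> contains both orientations of an edge,
    whence 1/2.\<close>
  define Z :: "nat \<Rightarrow> nat \<Rightarrow> real" where "Z u v = (\<Sum>e\<in>G. (1 / 2) * c e u * c e v)" for u v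
  have b_f: "b i (f j) = cycle_form i j" if "i \<in> {2..<k}" "j \<in> {1..k}" for i j
    using that f_eq[of j i] f_eq[of j "i + 1"] f_eq[of j 1] assms(3) by (auto simp: b_def cycle_form_def)
  have Y_f: "Y (f j) (f m) = cycle_gram k j m" if "j \<in> {1..k}" "m \<in> {1..k}" for j m
    unfolding Y_def cycle_gram_def by (intro sum.cong refl) (use that b_f in auto)
  have Y_out: "Y u v = 0" if "u \<notin> f ` {1..k} \<or> v \<notin> f ` {1..k}" for u v
  proof -
    have "b i w = 0" if "i \<in> {2..<k}" "w \<notin> f ` {1..k}" for i w
      using that by (auto simp: b_def)
    then show ?thesis unfolding Y_def by (intro sum.neutral) (use that in auto)
  qed
  have Y_sym: "Y u v = Y v u" for u v unfolding Y_def by (simp add: mult.commute)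
  have Y_nonneg: "0 \<le> Y u v" for u v
    using Y_out[of u v] Y_f cycle_gram_nonneg[OF _ _ assms(2,3)] by (cases "u \<in> f ` {1..k} \<and> v \<in> f ` {1..k}") auto
  have Y_edge: "(f j, f m) \<in> G" if "j \<in> {1..k}" "m \<in> {1..k}" "j < m" "Y (f j) (f m) \<noteq> 0" for j m
  proof -
    have nz: "cycle_gram k j m \<noteq> 0" using that Y_f by simp
    have "(j, m) \<in> cycle_graph k"
    proof (cases "j = 1")
      case True
      then have "m = 2 \<or> m = k" using nz cycle_gram_first_row[of m k] that assms(2,3) by auto
      then show ?thesis using True that assms(3) by (subst cycle_graph_iff) auto
    next
      case False
      then have "m = j + 1" using nz cycle_gram_zero[of j m k] that by force
      then show ?thesis using that assms(3) by (subst cycle_graph_iff) auto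
    qed
    then show ?thesis by (rule f(3))
  qed
  have Y_supp: "(u, v) \<in> G" if uv: "u \<noteq> v" "Y u v \<noteq> 0" for u v
  proof -
    obtain j m where jm: "u = f j" "v = f m" "j \<in> {1..k}" "m \<in> {1..k}" using Y_out[of u v] uv by blast
    have "j \<noteq> m" using jm(1,2) uv(1) by auto
    then have "j < m \<or> m < j" by auto
    then show ?thesis using Y_edge[of j m] Y_edge[of m j] jm uv Y_sym[of u v] G_sym by auto
  qed
  have Z_off: "Z u v = of_bool ((u, v) \<in> G)" if "u \<noteq> v" for u v
  proof -
    have "Z u v = (\<Sum>e\<in>G. (if e = (u, v) then 1 / 2 else 0) + (if e = (v, u) then 1 / 2 else 0))"
      unfolding Z_def by (intro sum.cong refl) (use that G_irr in \<open>auto simp: c_def\<close>)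
    then show ?thesis using finG G_sym[of u v] G_sym[of v u] by (auto simp: sum.distrib)
  qed
  have Z_nonneg: "0 \<le> Z u v" for u v
    unfolding Z_def by (intro sum_nonneg) (auto simp: c_def)
  define X where "X \<epsilon> u v = Y u v + \<epsilon> * Z u v" for \<epsilon> u v
  have psdY: "psd_on {1..n} Y" and psdZ: "psd_on {1..n} Z"
    unfolding Y_def Z_def by (intro psd_on_rank1_sum finG; simp)+
  have X_cpsd: "cpsd n (X \<epsilon>)" if "0 < \<epsilon>" for \<epsilon>
  proof -
    have "psd_on {1..n} (X \<epsilon>)"
      unfolding X_def by (intro psd_on_add psd_on_scale psdY psdZ) (use that in auto)
    then have "DNN n (X \<epsilon>)"
      using Y_nonneg Z_nonneg that
      by (simp add: DNN_def real_psd_def real_symmetric_def psd_on_def quad_def X_def)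
    moreover have "support_graph n (X \<epsilon>) = G"
    proof -
      have "X \<epsilon> u v \<noteq> 0 \<longleftrightarrow> (u, v) \<in> G" if "u \<noteq> v" for u v
        using Y_supp[OF that] Y_nonneg[of u v] Z_off[OF that] \<open>0 < \<epsilon>\<close>
        by (cases "(u, v) \<in> G") (auto simp: X_def)
      then have "(u, v) \<in> support_graph n (X \<epsilon>) \<longleftrightarrow> (u, v) \<in> G" for u v
        using G_sub G_irr[of u] by (cases "u = v") (auto simp: support_graph_def)
      then show ?thesis by auto
    qed
    ultimately show ?thesis using cpsd_graph by (auto simp: cpsd_graph_def)
  qed
  \<comment> \<open>The kernel vector of the cycle matrix, carried along \<open>f\<close> and zero
    elsewhere. It is 0 at \<open>f 1\<close>, 1 at \<open>f 2\<close> and, as \<open>k\<close> is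
    odd, -1 at \<open>f k\<close>.\<close>
  define w :: "nat \<Rightarrow> real" where "w u = (\<Sum>i\<in>{2..k}. (-1) ^ i * of_bool (u = f i))" for u
  have w_f: "w (f j) = (if 2 \<le> j then (-1) ^ j else 0)" if "j \<in> {1..k}" for j
  proof -
    have "w (f j) = (\<Sum>i\<in>{2..k}. if i = j then (-1) ^ i else 0)"
      unfolding w_def by (intro sum.cong refl) (use that f_eq[of j] in auto)
    then show ?thesis using that by auto
  qed
  have w_out: "w u = 0" if "u \<notin> f ` {1..k}" for u
    unfolding w_def by (intro sum.neutral) (use that in auto)
  have quadY: "quad {1..n} Y w = 0"
  proof -
    have bw: "(\<Sum>u\<in>{1..n}. b i u * w u) = 0" if i: "i \<in> {2..<k}" for i
    proof -
      have mem: "f i \<in> {1..n}" "f (i + 1) \<in> {1..n}" "f 1 \<in> {1..n}"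
        using i by (intro f_in; simp)+
      have "(\<Sum>u\<in>{1..n}. b i u * w u) = (\<Sum>u\<in>{1..n}. (if u = f i then w u else 0)
          + (if u = f (i + 1) then w u else 0) + (if u = f 1 then (-1) ^ i * w u else 0))"
        by (intro sum.cong refl) (auto simp: b_def algebra_simps)
      also have "\<dots> = w (f i) + w (f (i + 1)) + (-1) ^ i * w (f 1)"
        using mem by (simp add: sum.distrib)
      also have "\<dots> = 0" using w_f[of i] w_f[of "i + 1"] w_f[of 1] i by simp
      finally show ?thesis .
    qed
    have "quad {1..n} Y w = frob {1..n} Y (\<lambda>u v. w u * w v)"
      by (subst frob_commute) (simp only: frob_rank1)
    also have "\<dots> = (\<Sum>i\<in>{2..<k}. 1 * (\<Sum>u\<in>{1..n}. w u * b i u)\<^sup>2)"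
      unfolding Y_def by (simp only: mult.assoc frob_sum_left frob_scale_left frob_rank1 quad_rank1)
    also have "\<dots> = 0" using bw by (simp add: mult.commute)
    finally show ?thesis .
  qed
  \<comment> \<open>Bounds the squared norms of all embedded factors for
    \<open>\<epsilon> \<le> 1\<close>; the 2 comes from \<open>frob_real_embedding\<close>.\<close>
  define N where "N = 2 * (\<Sum>u\<in>{1..n}. Y u u + Z u u)"
  define q where "q = quad {1..n} Z w"
  have q: "0 \<le> q" unfolding q_def using psd_on_nonneg[OF psdZ] .
  have N: "0 \<le> N" unfolding N_def using Y_nonneg Z_nonneg by (simp add: sum_nonneg)
  \<comment> \<open>The bound of \<open>almost_kernel_vector_bound\<close> for the errors
    \<open>2 * \<epsilon>\<close> and \<open>2 * \<epsilon> * q\<close>, with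
    \<open>sqrt \<epsilon>\<close> factored out. It depends neither on \<open>\<epsilon>\<close> nor
    on the size of the factors.\<close>
  define \<kappa> where "\<kappa> = sqrt N * sqrt 2 + sqrt N * sqrt (2 * q) + n * (sqrt 2 * sqrt N)"
  have "0 \<le> \<kappa>" unfolding \<kappa>_def using N q by simp
  have one: "1 \<in> {1..k}" "2 \<in> {1..k}" "k \<in> {1..k}" using assms(3) by auto
  have bound: "2 \<le> \<kappa> * sqrt \<epsilon>" if \<epsilon>: "0 < \<epsilon>" "\<epsilon> \<le> 1" for \<epsilon>
  proof -
    obtain d P where P: "\<forall>u\<in>{1..n}. hermitian_psd d (P u)"
      "\<forall>u\<in>{1..n}. \<forall>v\<in>{1..n}. complex_of_real (X \<epsilon> u v) = trace_prod d (P u) (P v)"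
      using X_cpsd[OF \<epsilon>(1)] unfolding cpsd_def by blast
    let ?I = "{..<d} \<times> (UNIV :: bool set)"
    define M where "M u = real_embedding (P u)" for u
    have frobM: "frob ?I (M u) (M v) = 2 * X \<epsilon> u v" if uv: "u \<in> {1..n}" "v \<in> {1..n}" for u v
    proof -
      have "hermitian d (P v)" using P(1) uv by (simp add: hermitian_psd_def)
      then have "frob ?I (M u) (M v) = 2 * Re (complex_of_real (X \<epsilon> u v))"
        unfolding M_def using P(2) uv by (subst frob_real_embedding) auto
      then show ?thesis by simp
    qed
    have "frob ?I (M (f 1)) (M (f 2)) \<le> sqrt N * sqrt (2 * \<epsilon>) + sqrt N * sqrt (2 * \<epsilon> * q)
      + card {1..n} * (sqrt (2 * \<epsilon>) * sqrt N)"
    proof (rule almost_kernel_vector_bound[where c = "f k" and w = w])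
      show "finite ?I" "finite {1..n}" "0 \<le> 2 * \<epsilon>" using \<epsilon> by auto
      show "psd_on ?I (M u)" if "u \<in> {1..n}" for u
        unfolding M_def using P(1) that by (intro psd_on_real_embedding) auto
      show "f 1 \<in> {1..n}" "f 2 \<in> {1..n}" "f k \<in> {1..n}" using f(2) one by blast+
      show "distinct [f 1, f 2, f k]" using one f_eq assms(3) by auto
      show "w (f 1) = 0" "w (f 2) = 1" "w (f k) = -1" using w_f one assms(2,3) by auto
      show "\<bar>w u\<bar> \<le> 1" for u
        using w_out[of u] w_f by (cases "u \<in> f ` {1..k}") (auto simp: power_abs)
      show "frob ?I (M u) (M u) \<le> N" if u: "u \<in> {1..n}" for u
      proof -
        have "X \<epsilon> u u \<le> Y u u + Z u u"
          unfolding X_def using \<epsilon> Z_nonneg[of u u] by (simp add: mult_left_le_one_le)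
        also have "\<dots> \<le> (\<Sum>u\<in>{1..n}. Y u u + Z u u)"
          using u Y_nonneg Z_nonneg by (intro member_le_sum) auto
        finally show ?thesis using frobM[OF u u] by (simp add: N_def)
      qed
      \<comment> \<open>Where the cycle matrix vanishes, only the perturbation is left, and
        off-diagonal entries of \<open>Z\<close> are at most 1.\<close>
      have small: "frob ?I (M (f i)) (M (f j)) \<le> 2 * \<epsilon>"
        if "i \<in> {1..k}" "j \<in> {1..k}" "i \<noteq> j" "cycle_gram k i j = 0" for i j
      proof -
        have "f i \<in> {1..n}" "f j \<in> {1..n}" "f i \<noteq> f j" using f_in f_eq that by auto
        then show ?thesis
          using frobM[of "f i" "f j"] Y_f[of i j] Z_off[of "f i" "f j"] that \<epsilon> by (simp add: X_def)
      qed
      show "frob ?I (M (f 1)) (M u) \<le> 2 * \<epsilon>" if u: "u \<in> {1..n} - {f 1, f 2, f k}" "w u \<noteq> 0" for u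
      proof -
        obtain j where j: "u = f j" "j \<in> {1..k}" using w_out u by blast
        have "j \<noteq> 1" "j \<noteq> 2" "j \<noteq> k" using j u by auto
        moreover from this have "cycle_gram k 1 j = 0"
          using cycle_gram_first_row[of j k] j assms(2,3) by auto
        ultimately show ?thesis unfolding j(1) by (intro small one j) auto
      qed
      show "frob ?I (M (f 2)) (M (f k)) \<le> 2 * \<epsilon>"
        by (rule small[OF one(2,3)]) (use assms(3) cycle_gram_zero[of 2 k k] in auto)
      let ?W = "\<lambda>i j. \<Sum>m\<in>{1..n}. w m * M m i j"
      \<comment> \<open>The squared norm of the combination is twice the form of
        \<open>X \<epsilon>\<close> at \<open>w\<close>; the part from \<open>Y\<close>
        vanishes.\<close>
      have "frob ?I ?W ?W = (\<Sum>u\<in>{1..n}. w u * frob ?I (M u) ?W)"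
        by (simp only: frob_sum_left frob_scale_left)
      also have "\<dots> = (\<Sum>u\<in>{1..n}. w u * (\<Sum>v\<in>{1..n}. w v * frob ?I (M v) (M u)))"
        by (simp only: frob_commute[of ?I "M _" ?W] frob_sum_left frob_scale_left)
      also have "\<dots> = quad {1..n} (\<lambda>u v. 2 * X \<epsilon> u v) w"
        unfolding quad_def sum_distrib_left
        by (intro sum.cong refl) (simp add: frobM X_def Y_sym psd_on_sym[OF psdZ] algebra_simps)
      also have "\<dots> = 2 * \<epsilon> * q"
        unfolding quad_scale_matrix X_def quad_add_matrix quadY q_def by simp
      finally show "frob ?I ?W ?W \<le> 2 * \<epsilon> * q" by simp
    qed
    also have "\<dots> = \<kappa> * sqrt \<epsilon>"
      unfolding \<kappa>_def by (simp add: real_sqrt_mult algebra_simps)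
    finally have "frob ?I (M (f 1)) (M (f 2)) \<le> \<kappa> * sqrt \<epsilon>" .
    moreover have "frob ?I (M (f 1)) (M (f 2)) \<ge> 2"
    proof -
      have "f 1 \<in> {1..n}" "f 2 \<in> {1..n}" using f(2) one by blast+
      then show ?thesis
        using frobM[of "f 1" "f 2"] Y_f[OF one(1,2)] cycle_gram_first_row[of 2 k] assms(2,3)
          Z_nonneg[of "f 1" "f 2"] \<epsilon>(1) by (simp add: X_def)
    qed
    ultimately show ?thesis by linarith
  qed
  \<comment> \<open>This \<open>\<epsilon>\<close> is at most 1 and turns the bound into
    \<open>\<kappa> / (\<kappa> + 1)\<close>, which is less than 2.\<close>
  have "2 \<le> \<kappa> * sqrt ((1 / (\<kappa> + 1))\<^sup>2)"
    by (rule bound) (use \<open>0 \<le> \<kappa>\<close> in \<open>auto simp: power_le_one\<close>)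
  also have "\<dots> = \<kappa> / (\<kappa> + 1)" using \<open>0 \<le> \<kappa>\<close> by simp
  also have "\<dots> \<le> 1" using \<open>0 \<le> \<kappa>\<close> by simp
  finally show False by simp
qed

theorem theorem6p5:
  fixes n :: nat and G :: "(nat \<times> nat) set"
  assumes "is_graph n G"
  shows "cpsd_graph n G \<longleftrightarrow>
    \<not> (\<exists>t::nat. t \<ge> 2 \<and> has_subgraph_iso n G (2 * t + 1) (cycle_graph (2 * t + 1)))"
proof
  assume "cpsd_graph n G"
  then show "\<not> (\<exists>t::nat. t \<ge> 2 \<and> has_subgraph_iso n G (2 * t + 1) (cycle_graph (2 * t + 1)))"
    using cpsd_graph_imp_no_long_odd_cycle[OF assms] by fastforce
next
  assume no_cycle: "\<not> (\<exists>t::nat. t \<ge> 2 \<and> has_subgraph_iso n G (2 * t + 1) (cycle_graph (2 * t + 1)))"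
  show "cpsd_graph n G"
    unfolding cpsd_graph_def
  proof (intro allI impI, elim conjE)
    fix X assume X: "DNN n X" "support_graph n X = G"
    have "support_on {1..n} X = G" using X(2) by (simp add: support_on_def support_graph_def)
    then have "\<not> long_odd_cycle (support_on {1..n} X)"
      using long_odd_cycle_imp_subgraph[OF assms] no_cycle by blast
    then have "completely_positive {1..n} X"
      using X(1) by (intro doubly_nonnegative_imp_completely_positive)
        (auto simp: DNN_def real_psd_def real_symmetric_def psd_on_def quad_def)
    then show "cpsd n X" by (rule completely_positive_imp_cpsd)
  qed
qed

end
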